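(* Let $\Lambda$ be a row-finite locally convex $k$-graph and $R$ a unital commutative ring. Then $\mathrm{KP}_R(\Lambda)$ is a prime ring if and only if $R$ is an integral domain and $\Lambda^0$ satisfies Condition (MT3), i.e. for all $v_1,v_2\in\Lambda^0$ there is $w\in\Lambda^0$ with $v_1\Lambda w\neq\emptyset$ and $v_2\Lambda w\neq\emptyset$.
   Context: A $k$-graph is a countable category $\Lambda$ (vertices $\Lambda^0$; range, source $r,s$) with functor $d:\Lambda\to\mathbb{N}^k$ with unique factorization ($d(\lambda)=m+n$ gives unique $\lambda=\mu\nu$ with $d(\mu)=m$, $d(\nu)=n$). $v\Lambda w=\{\lambda:r(\lambda)=v,s(\lambda)=w\}$, $v\Lambda^n=\{\lambda:r(\lambda)=v,d(\lambda)=n\}$; row-finite: each $v\Lambda^n$ finite. Locally convex: for $v\in\Lambda^0$, $i\ne j$, $\lambda\in v\Lambda^{e_i}$, $\mu\in v\Lambda^{e_j}$, the sets $s(\lambda)\Lambda^{e_j}$, $s(\mu)\Lambda^{e_i}$ are nonempty. $\Lambda^{\le n}=\{\lambda: d(\lambda)\le n,\ s(\lambda)\Lambda^{e_i}=\emptyset \text{ whenever } d(\lambda)+e_i\le n\}$. $\mathrm{KP}_R(\Lambda)$ is the universal $R$-algebra generated by $p_v$ ($v\in\Lambda^0$), $s_\lambda,s_{\lambda^*}$ ($d(\lambda)\ne0$) subject to: the $p_v$ are mutually orthogonal idempotents; $s_\lambda s_\mu=s_{\lambda\mu}$, $s_{\mu^*}s_{\lambda^*}=s_{(\lambda\mu)^*}$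 when $s(\lambda)=r(\mu)$, $p_{r(\lambda)}s_\lambda=s_\lambda p_{s(\lambda)}=s_\lambda$, $p_{s(\lambda)}s_{\lambda^*}=s_{\lambda^*}p_{r(\lambda)}=s_{\lambda^*}$; $s_{\lambda^*}s_\mu=\delta_{\lambda,\mu}p_{s(\lambda)}$ for $\lambda,\mu\in\Lambda^{\le n}$, $n\in\mathbb{N}^k\setminus\{0\}$; $p_v=\sum_{\lambda\in v\Lambda^{\le n}}s_\lambda s_{\lambda^*}$ for $n\in\mathbb{N}^k\setminus\{0\}$ (convention $s_v=s_{v^*}=p_v$). A ring is prime if its zero ideal is prime. *)

theory Defs
  imports Main "HOL-Library.Function_Algebras" "HOL-Library.Countable_Set"
begin

text \<open>A k-graph is given by its set of morphisms M, the set V of vertices (= objects,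
identified with the identity morphisms, so V is a subset of M), range r, source s,
composition c (c l m is l followed-by-the-left m, i.e. the path lm with s l = r m)
and degree functor d with values in N^k, represented as functions nat => nat
vanishing from k on.\<close>

definition is_kgraph ::
  "nat \<Rightarrow> 'm set \<Rightarrow> 'm set \<Rightarrow> ('m \<Rightarrow> 'm) \<Rightarrow> ('m \<Rightarrow> 'm) \<Rightarrow> ('m \<Rightarrow> 'm \<Rightarrow> 'm)
   \<Rightarrow> ('m \<Rightarrow> nat \<Rightarrow> nat) \<Rightarrow> bool" where
  "is_kgraph k M V r s c d \<longleftrightarrow>
     countable M \<and> V \<subseteq> M \<and>
     (\<forall>l\<in>M. r l \<in> V \<and> s l \<in> V) \<and>
     (\<forall>v\<in>V. r v = v \<and> s v = v) \<and>
     (\<forall>l\<in>M. \<forall>m\<in>M. s l = r m \<longrightarrow> c l m \<in> M \<and> r (c l m) = r l \<and> s (c l m) = s m) \<and>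
     (\<forall>l\<in>M. c (r l) l = l \<and> c l (s l) = l) \<and>
     (\<forall>l\<in>M. \<forall>m\<in>M. \<forall>n\<in>M. s l = r m \<and> s m = r n \<longrightarrow> c (c l m) n = c l (c m n)) \<and>
     (\<forall>l\<in>M. \<forall>i\<ge>k. d l i = 0) \<and>
     (\<forall>v\<in>V. d v = 0) \<and>
     (\<forall>l\<in>M. \<forall>m\<in>M. s l = r m \<longrightarrow> d (c l m) = d l + d m) \<and>
     (\<forall>l\<in>M. \<forall>p q. d l = p + q \<longrightarrow>
        (\<exists>!x. fst x \<in> M \<and> snd x \<in> M \<and> s (fst x) = r (snd x) \<and>
              c (fst x) (snd x) = l \<and> d (fst x) = p \<and> d (snd x) = q))"

definition ev :: "nat \<Rightarrow> nat \<Rightarrow> nat" where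
  "ev i = (\<lambda>j. if j = i then 1 else 0)"

definition NK_nonzero :: "nat \<Rightarrow> (nat \<Rightarrow> nat) set" where
  "NK_nonzero k = {n. n \<noteq> 0 \<and> (\<forall>i\<ge>k. n i = 0)}"

definition row_finite :: "'m set \<Rightarrow> 'm set \<Rightarrow> ('m \<Rightarrow> 'm) \<Rightarrow> ('m \<Rightarrow> nat \<Rightarrow> nat) \<Rightarrow> bool" where
  "row_finite M V r d \<longleftrightarrow> (\<forall>v\<in>V. \<forall>n. finite {l\<in>M. r l = v \<and> d l = n})"

definition locally_convex ::
  "nat \<Rightarrow> 'm set \<Rightarrow> 'm set \<Rightarrow> ('m \<Rightarrow> 'm) \<Rightarrow> ('m \<Rightarrow> 'm) \<Rightarrow> ('m \<Rightarrow> nat \<Rightarrow> nat) \<Rightarrow> bool" where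
  "locally_convex k M V r s d \<longleftrightarrow>
     (\<forall>v\<in>V. \<forall>i<k. \<forall>j<k. i \<noteq> j \<longrightarrow>
        (\<forall>l\<in>M. \<forall>m\<in>M. r l = v \<and> d l = ev i \<and> r m = v \<and> d m = ev j \<longrightarrow>
           (\<exists>a\<in>M. r a = s l \<and> d a = ev j) \<and> (\<exists>b\<in>M. r b = s m \<and> d b = ev i)))"

definition LE_paths ::
  "nat \<Rightarrow> 'm set \<Rightarrow> ('m \<Rightarrow> 'm) \<Rightarrow> ('m \<Rightarrow> 'm) \<Rightarrow> ('m \<Rightarrow> nat \<Rightarrow> nat) \<Rightarrow> (nat \<Rightarrow> nat) \<Rightarrow> 'm set" where
  "LE_paths k M r s d n = {l\<in>M. d l \<le> n \<and>
      (\<forall>i<k. d l + ev i \<le> n \<longrightarrow> \<not> (\<exists>a\<in>M. r a = s l \<and> d a = ev i))}"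

definition MT3 :: "'m set \<Rightarrow> 'm set \<Rightarrow> ('m \<Rightarrow> 'm) \<Rightarrow> ('m \<Rightarrow> 'm) \<Rightarrow> bool" where
  "MT3 M V r s \<longleftrightarrow> (\<forall>v1\<in>V. \<forall>v2\<in>V. \<exists>w\<in>V.
      (\<exists>l\<in>M. r l = v1 \<and> s l = w) \<and> (\<exists>m\<in>M. r m = v2 \<and> s m = w))"

definition integral_domain_ring :: "'r::comm_ring_1 itself \<Rightarrow> bool" where
  "integral_domain_ring _ \<longleftrightarrow> (1::'r) \<noteq> 0 \<and> (\<forall>a b::'r. a * b = 0 \<longrightarrow> a = 0 \<or> b = 0)"

definition rng_ideal ::
  "'a set \<Rightarrow> ('a \<Rightarrow> 'a \<Rightarrow> 'a) \<Rightarrow> ('a \<Rightarrow> 'a \<Rightarrow> 'a) \<Rightarrow> ('a \<Rightarrow> 'a) \<Rightarrow> 'a \<Rightarrow> 'a set \<Rightarrow> bool" where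
  "rng_ideal C add mul neg z I \<longleftrightarrow> I \<subseteq> C \<and> z \<in> I \<and>
     (\<forall>a\<in>I. \<forall>b\<in>I. add a b \<in> I) \<and> (\<forall>a\<in>I. neg a \<in> I) \<and>
     (\<forall>a\<in>I. \<forall>x\<in>C. mul x a \<in> I \<and> mul a x \<in> I)"

definition prime_rng ::
  "'a set \<Rightarrow> ('a \<Rightarrow> 'a \<Rightarrow> 'a) \<Rightarrow> ('a \<Rightarrow> 'a \<Rightarrow> 'a) \<Rightarrow> ('a \<Rightarrow> 'a) \<Rightarrow> 'a \<Rightarrow> bool" where
  "prime_rng C add mul neg z \<longleftrightarrow> C \<noteq> {z} \<and>
     (\<forall>I J. rng_ideal C add mul neg z I \<and> rng_ideal C add mul neg z J \<and>
        (\<forall>a\<in>I. \<forall>b\<in>J. mul a b = z) \<longrightarrow> I = {z} \<or> J = {z})"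

definition fa_carrier :: "'g set \<Rightarrow> ('g list \<Rightarrow> 'r::comm_ring_1) set" where
  "fa_carrier G = {f. finite {w. f w \<noteq> 0} \<and> (\<forall>w. f w \<noteq> 0 \<longrightarrow> w \<noteq> [] \<and> set w \<subseteq> G)}"

definition fa_mul :: "('g list \<Rightarrow> 'r::comm_ring_1) \<Rightarrow> ('g list \<Rightarrow> 'r) \<Rightarrow> 'g list \<Rightarrow> 'r" where
  "fa_mul f g = (\<lambda>w. \<Sum>i\<in>{0..length w}. f (take i w) * g (drop i w))"

definition fa_smul :: "'r::comm_ring_1 \<Rightarrow> ('g list \<Rightarrow> 'r) \<Rightarrow> 'g list \<Rightarrow> 'r" where
  "fa_smul a f = (\<lambda>w. a * f w)"

definition fa_gen :: "'g \<Rightarrow> 'g list \<Rightarrow> 'r::comm_ring_1" where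
  "fa_gen x = (\<lambda>w. if w = [x] then 1 else 0)"

definition fa_ideal :: "'g set \<Rightarrow> ('g list \<Rightarrow> 'r::comm_ring_1) set \<Rightarrow> bool" where
  "fa_ideal G J \<longleftrightarrow> J \<subseteq> fa_carrier G \<and> 0 \<in> J \<and> (\<forall>f\<in>J. \<forall>g\<in>J. f + g \<in> J) \<and>
     (\<forall>a. \<forall>f\<in>J. fa_smul a f \<in> J) \<and>
     (\<forall>f\<in>J. \<forall>g\<in>fa_carrier G. fa_mul f g \<in> J \<and> fa_mul g f \<in> J)"

definition fa_gen_ideal :: "'g set \<Rightarrow> ('g list \<Rightarrow> 'r::comm_ring_1) set \<Rightarrow> ('g list \<Rightarrow> 'r) set" where
  "fa_gen_ideal G S = \<Inter>{J. fa_ideal G J \<and> S \<subseteq> J}"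

definition q_coset :: "'g set \<Rightarrow> ('g list \<Rightarrow> 'r::comm_ring_1) set \<Rightarrow> ('g list \<Rightarrow> 'r) \<Rightarrow> ('g list \<Rightarrow> 'r) set" where
  "q_coset G I f = {g\<in>fa_carrier G. g - f \<in> I}"

definition q_rep :: "'a set \<Rightarrow> 'a" where
  "q_rep X = (SOME x. x \<in> X)"

definition q_carrier :: "'g set \<Rightarrow> ('g list \<Rightarrow> 'r::comm_ring_1) set \<Rightarrow> ('g list \<Rightarrow> 'r) set set" where
  "q_carrier G I = q_coset G I ` fa_carrier G"

definition q_add where "q_add G I X Y = q_coset G I (q_rep X + q_rep Y)"
definition q_mul where "q_mul G I X Y = q_coset G I (fa_mul (q_rep X) (q_rep Y))"
definition q_neg where "q_neg G I X = q_coset G I (- q_rep X)"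
definition q_zero where "q_zero G I = q_coset G I 0"

datatype 'm kpgen = Pg 'm | Sg 'm | Sstg 'm

definition kp_gens :: "'m set \<Rightarrow> 'm set \<Rightarrow> ('m \<Rightarrow> nat \<Rightarrow> nat) \<Rightarrow> 'm kpgen set" where
  "kp_gens M V d = Pg ` V \<union> Sg ` {l\<in>M. d l \<noteq> 0} \<union> Sstg ` {l\<in>M. d l \<noteq> 0}"

definition kpP :: "'m \<Rightarrow> 'm kpgen list \<Rightarrow> 'r::comm_ring_1" where
  "kpP v = fa_gen (Pg v)"

text \<open>Convention s_v = s_{v*} = p_v for degree-zero paths (vertices).\<close>
definition kpS :: "('m \<Rightarrow> nat \<Rightarrow> nat) \<Rightarrow> 'm \<Rightarrow> 'm kpgen list \<Rightarrow> 'r::comm_ring_1" where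
  "kpS d l = (if d l = 0 then fa_gen (Pg l) else fa_gen (Sg l))"

definition kpSst :: "('m \<Rightarrow> nat \<Rightarrow> nat) \<Rightarrow> 'm \<Rightarrow> 'm kpgen list \<Rightarrow> 'r::comm_ring_1" where
  "kpSst d l = (if d l = 0 then fa_gen (Pg l) else fa_gen (Sstg l))"

definition kp_rels ::
  "nat \<Rightarrow> 'm set \<Rightarrow> 'm set \<Rightarrow> ('m \<Rightarrow> 'm) \<Rightarrow> ('m \<Rightarrow> 'm) \<Rightarrow> ('m \<Rightarrow> 'm \<Rightarrow> 'm)
   \<Rightarrow> ('m \<Rightarrow> nat \<Rightarrow> nat) \<Rightarrow> ('m kpgen list \<Rightarrow> 'r::comm_ring_1) set" where
  "kp_rels k M V r s c d =
     {fa_mul (kpP v) (kpP w) - (if v = w then kpP v else 0) | v w. v \<in> V \<and> w \<in> V}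
   \<union> {fa_mul (kpS d l) (kpS d m) - kpS d (c l m) | l m. l \<in> M \<and> m \<in> M \<and> s l = r m}
   \<union> {fa_mul (kpSst d m) (kpSst d l) - kpSst d (c l m) | l m. l \<in> M \<and> m \<in> M \<and> s l = r m}
   \<union> {fa_mul (kpP (r l)) (kpS d l) - kpS d l | l. l \<in> M}
   \<union> {fa_mul (kpS d l) (kpP (s l)) - kpS d l | l. l \<in> M}
   \<union> {fa_mul (kpP (s l)) (kpSst d l) - kpSst d l | l. l \<in> M}
   \<union> {fa_mul (kpSst d l) (kpP (r l)) - kpSst d l | l. l \<in> M}
   \<union> {fa_mul (kpSst d l) (kpS d m) - (if l = m then kpP (s l) else 0) | l m n.
        n \<in> NK_nonzero k \<and> l \<in> LE_paths k M r s d n \<and> m \<in> LE_paths k M r s d n}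
   \<union> {kpP v - (\<Sum>l\<in>{l\<in>LE_paths k M r s d n. r l = v}. fa_mul (kpS d l) (kpSst d l)) | v n.
        v \<in> V \<and> n \<in> NK_nonzero k}"

definition kp_ideal ::
  "nat \<Rightarrow> 'm set \<Rightarrow> 'm set \<Rightarrow> ('m \<Rightarrow> 'm) \<Rightarrow> ('m \<Rightarrow> 'm) \<Rightarrow> ('m \<Rightarrow> 'm \<Rightarrow> 'm)
   \<Rightarrow> ('m \<Rightarrow> nat \<Rightarrow> nat) \<Rightarrow> ('m kpgen list \<Rightarrow> 'r::comm_ring_1) set" where
  "kp_ideal k M V r s c d = fa_gen_ideal (kp_gens M V d) (kp_rels k M V r s c d)"

definition KP_prime ::
  "'r::comm_ring_1 itself \<Rightarrow> nat \<Rightarrow> 'm set \<Rightarrow> 'm set \<Rightarrow> ('m \<Rightarrow> 'm) \<Rightarrow> ('m \<Rightarrow> 'm)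
   \<Rightarrow> ('m \<Rightarrow> 'm \<Rightarrow> 'm) \<Rightarrow> ('m \<Rightarrow> nat \<Rightarrow> nat) \<Rightarrow> bool" where
  "KP_prime _ k M V r s c d \<longleftrightarrow>
     (let G = kp_gens M V d; I = (kp_ideal k M V r s c d :: ('m kpgen list \<Rightarrow> 'r) set) in
      prime_rng (q_carrier G I) (q_add G I) (q_mul G I) (q_neg G I) (q_zero G I))"

end

theory Submission
  imports Defs
begin

text \<open>
  Every homogeneous element \<open>x \<notin> I\<close> of degree \<open>g\<close> is a combination of products \<open>s\<^sub>\<lambda> s\<^sub>\<mu>\<^sub>*\<close> with
  \<open>d(\<lambda>) - d(\<mu>) = g\<close>, and the Cuntz--Krieger relation allows all \<open>\<mu>\<close> to lie in one \<open>\<Lambda>\<^sup>\<le>\<^sup>n\<close>. Distinct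
  \<open>s\<^sub>\<mu>\<close> and distinct \<open>s\<^sub>\<lambda>\<close> of the same degree are then orthogonal, so some compression \<open>s\<^sub>\<lambda>\<^sub>* x s\<^sub>\<mu>\<close>
  equals a nonzero \<open>a p\<^sub>w\<close>. Applying this to the lexicographically leading components of two arbitrary
  nonzero elements, and moving both to a common vertex by (MT3), gives elements with leading
  components \<open>a p\<^sub>t\<close> and \<open>b p\<^sub>t\<close> in degree zero; their product has leading component \<open>a b p\<^sub>t\<close>.

  That \<open>a p\<^sub>v \<noteq> 0\<close> for \<open>a \<noteq> 0\<close> is seen in a representation on functions \<open>\<Lambda> \<rightarrow> R\<close> modulo those vanishing
  far out, which replaces the boundary path space and needs no infinite paths.

  Conversely, zero divisors \<open>a, b\<close> of \<open>R\<close> give the ideals \<open>a KP\<close> and \<open>b KP\<close>, and if (MT3) fails at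
  \<open>v\<^sub>1, v\<^sub>2\<close>, then the spanning set shows \<open>p\<^sub>v\<^sub>1 KP p\<^sub>v\<^sub>2 = 0\<close>.
\<close>

section \<open>Free algebras and their quotients\<close>

lemma sum_fun_apply: "(\<Sum>i\<in>A. f i) x = (\<Sum>i\<in>A. f i x)" for f :: "'i \<Rightarrow> 'a \<Rightarrow> 'b::comm_monoid_add"
  by (induction A rule: infinite_finite_induct) auto

definition mono_word :: "'g list \<Rightarrow> 'g list \<Rightarrow> 'r::comm_ring_1" where
  "mono_word u = (\<lambda>w. if w = u then 1 else 0)"

lemma fa_gen_eq_mono_word: "fa_gen x = mono_word [x]"
  by (simp add: fa_gen_def mono_word_def)

text \<open>Factorizations are kept as pairs of words instead of cut positions; sums over them can
  then be reindexed without arithmetic on indices.\<close>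

definition splits :: "'g list \<Rightarrow> ('g list \<times> 'g list) set" where
  "splits w = {p. fst p @ snd p = w}"

lemma splits_eq_image: "splits w = (\<lambda>i. (take i w, drop i w)) ` {0..length w}"
proof
  show "splits w \<subseteq> (\<lambda>i. (take i w, drop i w)) ` {0..length w}"
  proof
    fix p assume "p \<in> splits w"
    then have "p = (take (length (fst p)) w, drop (length (fst p)) w)" "length (fst p) \<in> {0..length w}"
      by (auto simp: splits_def)
    then show "p \<in> (\<lambda>i. (take i w, drop i w)) ` {0..length w}" by (rule image_eqI)
  qed
qed (auto simp: splits_def)

lemma finite_splits: "finite (splits w)"
  by (simp add: splits_eq_image)

lemma fa_mul_splits: "fa_mul f g w = (\<Sum>p\<in>splits w. f (fst p) * g (snd p))"
proof -
  have "inj_on (\<lambda>i. (take i w, drop i w)) {0..length w}"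
    by (rule inj_onI) (metis Pair_inject atLeastAtMost_iff length_take min.absorb2)
  then show ?thesis
    unfolding fa_mul_def splits_eq_image by (subst sum.reindex) auto
qed

text \<open>Both sides sum over the factorizations of a word into three pieces; the reindexing only
  moves the bracket around the middle piece.\<close>

lemma fa_mul_assoc: "fa_mul (fa_mul f g) h = fa_mul f (fa_mul g h)"
proof
  fix w
  have "fa_mul (fa_mul f g) h w = (\<Sum>p\<in>splits w. \<Sum>q\<in>splits (fst p). f (fst q) * g (snd q) * h (snd p))"
    by (simp add: fa_mul_splits sum_distrib_right)
  also have "\<dots> = (\<Sum>t\<in>(SIGMA p:splits w. splits (fst p)). f (fst (snd t)) * g (snd (snd t)) * h (snd (fst t)))"
    by (subst sum.Sigma) (auto simp: finite_splits case_prod_unfold)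
  also have "\<dots> = (\<Sum>t\<in>(SIGMA p:splits w. splits (snd p)). f (fst (fst t)) * (g (fst (snd t)) * h (snd (snd t))))"
    by (rule sum.reindex_bij_witness[of _ "\<lambda>((u,x),(v,z)). ((u@v,z),(u,v))" "\<lambda>((x,z),(u,v)). ((u,v@z),(v,z))"])
       (auto simp: mult.assoc splits_def)
  also have "\<dots> = (\<Sum>p\<in>splits w. \<Sum>q\<in>splits (snd p). f (fst p) * (g (fst q) * h (snd q)))"
    by (subst sum.Sigma) (auto simp: finite_splits case_prod_unfold)
  also have "\<dots> = fa_mul f (fa_mul g h) w"
    by (simp add: fa_mul_splits sum_distrib_left)
  finally show "fa_mul (fa_mul f g) h w = fa_mul f (fa_mul g h) w" .
qed

lemma fa_mul_add_left: "fa_mul (f + g) h = fa_mul f h + fa_mul g h"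
  by (auto simp: fa_mul_def fun_eq_iff sum.distrib algebra_simps)
lemma fa_mul_add_right: "fa_mul h (f + g) = fa_mul h f + fa_mul h g"
  by (auto simp: fa_mul_def fun_eq_iff sum.distrib algebra_simps)
lemma fa_mul_diff_left: "fa_mul (f - g) h = fa_mul f h - fa_mul g h"
  by (auto simp: fa_mul_def fun_eq_iff sum_subtractf algebra_simps)
lemma fa_mul_diff_right: "fa_mul h (f - g) = fa_mul h f - fa_mul h g"
  by (auto simp: fa_mul_def fun_eq_iff sum_subtractf algebra_simps)
lemma fa_mul_zero [simp]: "fa_mul 0 f = 0" "fa_mul f 0 = 0"
  by (auto simp: fa_mul_def fun_eq_iff)
lemma fa_mul_uminus_left: "fa_mul (- f) h = - fa_mul f h"
  by (auto simp: fa_mul_def fun_eq_iff sum_negf)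
lemma fa_mul_uminus_right: "fa_mul h (- f) = - fa_mul h f"
  by (auto simp: fa_mul_def fun_eq_iff sum_negf)
lemma fa_mul_smul_left: "fa_mul (fa_smul a f) h = fa_smul a (fa_mul f h)"
  by (auto simp: fa_mul_def fa_smul_def fun_eq_iff sum_distrib_left mult.assoc mult.left_commute intro!: sum.cong)
lemma fa_mul_smul_right: "fa_mul h (fa_smul a f) = fa_smul a (fa_mul h f)"
  by (auto simp: fa_mul_def fa_smul_def fun_eq_iff sum_distrib_left mult.assoc mult.left_commute intro!: sum.cong)
lemma fa_mul_sum_left: "fa_mul (sum f A) h = (\<Sum>x\<in>A. fa_mul (f x) h)"
  by (induction A rule: infinite_finite_induct)
     (simp_all only: sum.infinite sum.empty sum.insert fa_mul_zero fa_mul_add_left not_False_eq_True)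
lemma fa_mul_sum_right: "fa_mul h (sum f A) = (\<Sum>x\<in>A. fa_mul h (f x))"
  by (induction A rule: infinite_finite_induct)
     (simp_all only: sum.infinite sum.empty sum.insert fa_mul_zero fa_mul_add_right not_False_eq_True)

lemma fa_smul_add: "fa_smul a (f + g) = fa_smul a f + fa_smul a g"
  by (auto simp: fa_smul_def fun_eq_iff algebra_simps)
lemma fa_smul_diff: "fa_smul a (f - g) = fa_smul a f - fa_smul a g"
  by (auto simp: fa_smul_def fun_eq_iff algebra_simps)
lemma fa_smul_add_scalar: "fa_smul (a + b) f = fa_smul a f + fa_smul b f"
  by (auto simp: fa_smul_def fun_eq_iff algebra_simps)
lemma fa_smul_smul: "fa_smul a (fa_smul b f) = fa_smul (a * b) f"
  by (auto simp: fa_smul_def fun_eq_iff algebra_simps)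
lemma fa_smul_simps [simp]: "fa_smul 0 f = 0" "fa_smul 1 f = f" "fa_smul a 0 = 0" "fa_smul (- 1) f = - f"
  by (auto simp: fa_smul_def fun_eq_iff)
lemma fa_smul_sum: "fa_smul a (sum f A) = (\<Sum>x\<in>A. fa_smul a (f x))"
  by (induction A rule: infinite_finite_induct)
     (simp_all only: sum.infinite sum.empty sum.insert fa_smul_simps fa_smul_add not_False_eq_True)

lemma mono_word_mul: "fa_mul (mono_word u) (mono_word v) = mono_word (u @ v)"
proof
  fix w
  have "fa_mul (mono_word u) (mono_word v) w
      = (\<Sum>p\<in>splits w. if p = (u,v) then 1 else (0::'b))"
    unfolding fa_mul_splits by (rule sum.cong) (auto simp: mono_word_def split: if_splits)
  also have "\<dots> = mono_word (u @ v) w"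
    by (subst sum.delta) (auto simp: finite_splits mono_word_def, auto simp: splits_def)
  finally show "fa_mul (mono_word u) (mono_word v) w = (mono_word (u @ v) w :: 'b)" .
qed

lemma fa_carrier_zero [simp]: "0 \<in> fa_carrier G"
  by (simp add: fa_carrier_def)
lemma fa_carrierI_supp:
  assumes "f \<in> fa_carrier G" "g \<in> fa_carrier G" "\<And>w. h w \<noteq> 0 \<Longrightarrow> f w \<noteq> 0 \<or> g w \<noteq> 0"
  shows "h \<in> fa_carrier G"
proof -
  have "{w. h w \<noteq> 0} \<subseteq> {w. f w \<noteq> 0} \<union> {w. g w \<noteq> 0}" using assms(3) by blast
  moreover have "finite ({w. f w \<noteq> 0} \<union> {w. g w \<noteq> 0})" using assms by (simp add: fa_carrier_def)
  ultimately have "finite {w. h w \<noteq> 0}" by (rule finite_subset)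
  then show ?thesis using assms unfolding fa_carrier_def by blast
qed

lemma fa_carrier_add [simp]: "f \<in> fa_carrier G \<Longrightarrow> g \<in> fa_carrier G \<Longrightarrow> f + g \<in> fa_carrier G"
  by (erule fa_carrierI_supp, assumption) auto
lemma fa_carrier_smul [simp]: "f \<in> fa_carrier G \<Longrightarrow> fa_smul a f \<in> fa_carrier G"
  by (erule fa_carrierI_supp[OF _ fa_carrier_zero]) (auto simp: fa_smul_def)
lemma fa_carrier_uminus [simp]: "f \<in> fa_carrier G \<Longrightarrow> - f \<in> fa_carrier G"
  using fa_carrier_smul[of f G "- 1"] by simp
lemma fa_carrier_diff [simp]: "f \<in> fa_carrier G \<Longrightarrow> g \<in> fa_carrier G \<Longrightarrow> f - g \<in> fa_carrier G"
  using fa_carrier_add[of f G "- g"] by simp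
lemma fa_carrier_sum [simp]: "(\<And>x. x \<in> A \<Longrightarrow> f x \<in> fa_carrier G) \<Longrightarrow> sum f A \<in> fa_carrier G"
  by (induction A rule: infinite_finite_induct) auto
lemma fa_carrier_mono_word: "w \<noteq> [] \<Longrightarrow> set w \<subseteq> G \<Longrightarrow> mono_word w \<in> fa_carrier G"
  by (auto simp: fa_carrier_def mono_word_def)
lemma fa_carrier_mul [simp]:
  assumes "f \<in> fa_carrier G" "g \<in> fa_carrier G" shows "fa_mul f g \<in> fa_carrier G"
proof -
  have nz: "\<exists>u v. w = u @ v \<and> f u \<noteq> 0 \<and> g v \<noteq> 0" if "fa_mul f g w \<noteq> 0" for w
  proof (rule ccontr)
    assume "\<not> ?thesis"
    then have "fa_mul f g w = 0"
      unfolding fa_mul_splits splits_def by (intro sum.neutral) (metis (mono_tags, lifting) mem_Collect_eq mult_zero_left mult_zero_right)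
    with that show False by simp
  qed
  have "{w. fa_mul f g w \<noteq> 0} \<subseteq> (\<lambda>(u,v). u @ v) ` ({u. f u \<noteq> 0} \<times> {v. g v \<noteq> 0})"
    using nz by (auto simp: image_iff)
  moreover have "finite \<dots>" using assms by (auto simp: fa_carrier_def)
  ultimately have "finite {w. fa_mul f g w \<noteq> 0}" using finite_subset by blast
  moreover have "w \<noteq> [] \<and> set w \<subseteq> G" if "fa_mul f g w \<noteq> 0" for w
    using nz[OF that] assms by (fastforce simp: fa_carrier_def)
  ultimately show ?thesis by (simp add: fa_carrier_def)
qed

lemma fa_eq_sum_mono_word:
  assumes "finite A" "{w. f w \<noteq> 0} \<subseteq> A"
  shows "f = (\<Sum>w\<in>A. fa_smul (f w) (mono_word w))"
proof
  fix w
  have "(\<Sum>u\<in>A. fa_smul (f u) (mono_word u)) w = (\<Sum>u\<in>A. if w = u then f u else 0)"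
    unfolding sum_fun_apply by (rule sum.cong) (auto simp: fa_smul_def mono_word_def)
  also have "\<dots> = f w" using assms by (auto simp: sum.delta)
  finally show "f w = (\<Sum>u\<in>A. fa_smul (f u) (mono_word u)) w" by simp
qed

section \<open>Congruence modulo an ideal and primeness of the quotient ring\<close>

locale fa_quotient =
  fixes G :: "'g set" and I :: "('g list \<Rightarrow> 'r::comm_ring_1) set"
  assumes ideal: "fa_ideal G I"
begin

abbreviation "C \<equiv> fa_carrier G :: ('g list \<Rightarrow> 'r) set"

lemma I_sub: "f \<in> I \<Longrightarrow> f \<in> C" using ideal by (auto simp: fa_ideal_def)
lemma I_zero [simp]: "0 \<in> I" using ideal by (auto simp: fa_ideal_def)
lemma I_add: "f \<in> I \<Longrightarrow> g \<in> I \<Longrightarrow> f + g \<in> I" using ideal by (auto simp: fa_ideal_def)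
lemma I_smul: "f \<in> I \<Longrightarrow> fa_smul a f \<in> I" using ideal by (auto simp: fa_ideal_def)
lemma I_uminus: "f \<in> I \<Longrightarrow> - f \<in> I" using I_smul[of f "- 1"] by simp
lemma I_diff: "f \<in> I \<Longrightarrow> g \<in> I \<Longrightarrow> f - g \<in> I" using I_add[of f "- g"] I_uminus by simp
lemma I_mul_left: "f \<in> C \<Longrightarrow> g \<in> I \<Longrightarrow> fa_mul f g \<in> I" using ideal by (auto simp: fa_ideal_def)
lemma I_mul_right: "f \<in> I \<Longrightarrow> g \<in> C \<Longrightarrow> fa_mul f g \<in> I" using ideal by (auto simp: fa_ideal_def)
lemma I_sum: "(\<And>x. x \<in> A \<Longrightarrow> f x \<in> I) \<Longrightarrow> sum f A \<in> I"
  by (induction A rule: infinite_finite_induct) (auto intro: I_add)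

text \<open>Membership in the carrier is built in, so that chains of congruences carry this side
  condition along.\<close>

definition cong :: "('g list \<Rightarrow> 'r) \<Rightarrow> ('g list \<Rightarrow> 'r) \<Rightarrow> bool" (infix "\<approx>" 50) where
  "f \<approx> g \<longleftrightarrow> f \<in> C \<and> g \<in> C \<and> f - g \<in> I"

lemma cong_carrier: "f \<approx> g \<Longrightarrow> f \<in> C" "f \<approx> g \<Longrightarrow> g \<in> C" by (auto simp: cong_def)
lemma cong_refl [simp]: "f \<approx> f \<longleftrightarrow> f \<in> C" by (auto simp: cong_def)
lemma cong_sym: "f \<approx> g \<Longrightarrow> g \<approx> f"
  using I_uminus[of "f - g"] by (auto simp: cong_def)
lemma cong_trans [trans]: "f \<approx> g \<Longrightarrow> g \<approx> h \<Longrightarrow> f \<approx> h"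
  using I_add[of "f - g" "g - h"] by (auto simp: cong_def)
lemma cong_eq_trans [trans]: "f \<approx> g \<Longrightarrow> g = h \<Longrightarrow> f \<approx> h" "f = g \<Longrightarrow> g \<approx> h \<Longrightarrow> f \<approx> h"
  by auto
lemma cong_zero_iff: "f \<approx> 0 \<longleftrightarrow> f \<in> I" by (auto simp: cong_def I_sub)
lemma cong_in_I_iff: "f \<approx> g \<Longrightarrow> f \<in> I \<longleftrightarrow> g \<in> I"
  by (metis cong_sym cong_trans cong_zero_iff)
lemma cong_add: "f \<approx> f' \<Longrightarrow> g \<approx> g' \<Longrightarrow> f + g \<approx> f' + g'"
  using I_add[of "f - f'" "g - g'"] by (auto simp: cong_def algebra_simps)
lemma cong_smul: "f \<approx> f' \<Longrightarrow> fa_smul a f \<approx> fa_smul a f'"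
  using I_smul[of "f - f'" a] by (auto simp: cong_def fa_smul_diff)
lemma cong_uminus: "f \<approx> f' \<Longrightarrow> - f \<approx> - f'"
  using cong_smul[of f f' "- 1"] by simp
lemma cong_mul:
  assumes "f \<approx> f'" "g \<approx> g'" shows "fa_mul f g \<approx> fa_mul f' g'"
proof -
  have "fa_mul f (g - g') \<in> I" "fa_mul (f - f') g' \<in> I"
    using assms by (auto simp: cong_def I_mul_left I_mul_right)
  then have "fa_mul f (g - g') + fa_mul (f - f') g' \<in> I" by (rule I_add)
  then show ?thesis using assms by (auto simp: cong_def fa_mul_diff_left fa_mul_diff_right)
qed
lemma cong_sum: "(\<And>x. x \<in> A \<Longrightarrow> f x \<approx> g x) \<Longrightarrow> sum f A \<approx> sum g A"
  by (induction A rule: infinite_finite_induct) (auto intro: cong_add)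

abbreviation "coset \<equiv> q_coset G I"

lemma coset_eq_iff: "f \<in> C \<Longrightarrow> g \<in> C \<Longrightarrow> coset f = coset g \<longleftrightarrow> f \<approx> g"
proof
  assume "f \<in> C" "g \<in> C" "coset f = coset g"
  moreover have "f \<in> coset f" using \<open>f \<in> C\<close> by (simp add: q_coset_def)
  ultimately have "f \<in> coset g" by (simp only:)
  then show "f \<approx> g" using \<open>g \<in> C\<close> by (simp add: q_coset_def cong_def)
next
  assume "f \<in> C" "g \<in> C" "f \<approx> g"
  then have "h \<approx> f \<longleftrightarrow> h \<approx> g" for h by (meson cong_sym cong_trans)
  then show "coset f = coset g" using \<open>f \<in> C\<close> \<open>g \<in> C\<close>
    by (auto simp: q_coset_def cong_def)
qed

text \<open>\<open>q_rep\<close> chooses an arbitrary member of a coset. Any choice is congruent to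
  \<open>f\<close>, which makes the operations defined through it well defined.\<close>

lemma q_rep_cong: "f \<in> C \<Longrightarrow> q_rep (coset f) \<approx> f"
proof -
  assume "f \<in> C"
  then have "f \<in> coset f" by (simp add: q_coset_def)
  then have "q_rep (coset f) \<in> coset f" unfolding q_rep_def by (rule someI[where P = "\<lambda>x. x \<in> coset f"])
  then show ?thesis using \<open>f \<in> C\<close> by (simp add: q_coset_def cong_def)
qed

lemma q_add_coset:
  assumes "f \<in> C" "g \<in> C" shows "q_add G I (coset f) (coset g) = coset (f + g)"
proof -
  have "q_rep (coset f) + q_rep (coset g) \<approx> f + g" using assms by (intro cong_add q_rep_cong)
  then show ?thesis using cong_carrier coset_eq_iff by (simp add: q_add_def)
qed

lemma q_mul_coset:
  assumes "f \<in> C" "g \<in> C" shows "q_mul G I (coset f) (coset g) = coset (fa_mul f g)"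
proof -
  have "fa_mul (q_rep (coset f)) (q_rep (coset g)) \<approx> fa_mul f g" using assms by (intro cong_mul q_rep_cong)
  then show ?thesis using cong_carrier coset_eq_iff by (simp add: q_mul_def)
qed

lemma q_neg_coset:
  assumes "f \<in> C" shows "q_neg G I (coset f) = coset (- f)"
proof -
  have "- q_rep (coset f) \<approx> - f" using assms by (intro cong_uminus q_rep_cong)
  then show ?thesis using cong_carrier coset_eq_iff by (simp add: q_neg_def)
qed

lemma coset_eq_zero_iff: "f \<in> C \<Longrightarrow> coset f = q_zero G I \<longleftrightarrow> f \<in> I"
  by (simp add: q_zero_def coset_eq_iff cong_zero_iff)

abbreviation "ring_ideal \<equiv> rng_ideal C (+) fa_mul uminus 0"
abbreviation "q_ideal \<equiv> rng_ideal (q_carrier G I) (q_add G I) (q_mul G I) (q_neg G I) (q_zero G I)"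
abbreviation "q_prime \<equiv> prime_rng (q_carrier G I) (q_add G I) (q_mul G I) (q_neg G I) (q_zero G I)"

lemma ring_ideal_sub: "ring_ideal A \<Longrightarrow> a \<in> A \<Longrightarrow> a \<in> C"
  by (auto simp: rng_ideal_def)

text \<open>Together with \<open>ring_ideal_vimage\<close> this transports ideals between the free
  algebra and the quotient, so that primeness can be treated on representatives.\<close>

lemma q_ideal_image:
  assumes "ring_ideal A" shows "q_ideal (coset ` A)"
proof -
  have sub: "a \<in> A \<Longrightarrow> a \<in> C" for a using assms by (rule ring_ideal_sub)
  show ?thesis using assms sub
    by (auto simp: rng_ideal_def q_carrier_def q_zero_def q_add_coset q_mul_coset q_neg_coset)
qed

lemma ring_ideal_vimage:
  assumes "q_ideal J" shows "ring_ideal {f \<in> C. coset f \<in> J}"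
proof -
  have "q_add G I (coset f) (coset g) \<in> J" if "coset f \<in> J" "coset g \<in> J" for f g
    using assms that by (auto simp: rng_ideal_def)
  moreover have "q_neg G I (coset f) \<in> J" if "coset f \<in> J" for f
    using assms that by (auto simp: rng_ideal_def)
  moreover have "q_mul G I (coset f) (coset g) \<in> J \<and> q_mul G I (coset g) (coset f) \<in> J"
    if "coset f \<in> J" "g \<in> C" for f g
    using assms that by (auto simp: rng_ideal_def q_carrier_def)
  ultimately show ?thesis using assms
    by (auto simp: rng_ideal_def q_zero_def simp flip: q_add_coset q_mul_coset q_neg_coset)
qed

lemma sub_I_if_coset_image:
  assumes "ring_ideal A" "coset ` A = {q_zero G I}" shows "A \<subseteq> I"
proof
  fix a assume a: "a \<in> A"
  then have "coset a = q_zero G I" using assms(2) by (metis imageI singletonD)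
  then show "a \<in> I" using coset_eq_zero_iff ring_ideal_sub[OF assms(1) a] by simp
qed

text \<open>The images of \<open>A\<close> and \<open>B\<close> annihilate each other in the
  quotient, and an image is zero only if the ideal lies in \<open>I\<close>.\<close>

lemma q_primeD:
  assumes "q_prime" "ring_ideal A" "ring_ideal B" "\<And>a b. a \<in> A \<Longrightarrow> b \<in> B \<Longrightarrow> fa_mul a b \<in> I"
  shows "A \<subseteq> I \<or> B \<subseteq> I"
proof -
  have "\<forall>a\<in>coset ` A. \<forall>b\<in>coset ` B. q_mul G I a b = q_zero G I"
    using assms ring_ideal_sub[OF assms(2)] ring_ideal_sub[OF assms(3)]
    by (auto simp: q_mul_coset coset_eq_zero_iff)
  then have "coset ` A = {q_zero G I} \<or> coset ` B = {q_zero G I}"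
    using assms(1) q_ideal_image[OF assms(2)] q_ideal_image[OF assms(3)] unfolding prime_rng_def by blast
  then show ?thesis
    using sub_I_if_coset_image[OF assms(2)] sub_I_if_coset_image[OF assms(3)] by metis
qed

lemma q_prime_carrier: "q_prime \<Longrightarrow> \<not> C \<subseteq> I"
proof
  assume "q_prime" "C \<subseteq> I"
  have "q_carrier G I = {q_zero G I}"
  proof (intro equalityI subsetI)
    fix X assume "X \<in> q_carrier G I"
    then obtain f where "f \<in> C" "X = coset f" by (auto simp: q_carrier_def)
    then show "X \<in> {q_zero G I}" using \<open>C \<subseteq> I\<close> by (simp add: coset_eq_zero_iff subsetD)
  qed (auto simp: q_carrier_def q_zero_def)
  then show False using \<open>q_prime\<close> by (simp add: prime_rng_def)
qed

text \<open>If two ideals annihilate each other and contain \<open>x\<close> and \<open>y\<close>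
  outside \<open>I\<close>, they also contain the sandwiched elements, whose product would then lie
  in \<open>I\<close>. The sandwich form is what compression by path elements delivers.\<close>

lemma q_primeI:
  assumes "\<not> C \<subseteq> I"
    and "\<And>x y. x \<in> C \<Longrightarrow> y \<in> C \<Longrightarrow> x \<notin> I \<Longrightarrow> y \<notin> I \<Longrightarrow>
       \<exists>a b e f. a \<in> C \<and> b \<in> C \<and> e \<in> C \<and> f \<in> C \<and>
         fa_mul (fa_mul (fa_mul a x) b) (fa_mul (fa_mul e y) f) \<notin> I"
  shows "q_prime"
  unfolding prime_rng_def
proof (intro conjI allI impI)
  show "q_carrier G I \<noteq> {q_zero G I}"
  proof
    assume *: "q_carrier G I = {q_zero G I}"
    have "f \<in> I" if "f \<in> C" for f
    proof -
      have "coset f \<in> q_carrier G I" using that by (simp add: q_carrier_def)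
      then show ?thesis using * that coset_eq_zero_iff by simp
    qed
    then show False using assms(1) by blast
  qed
next
  fix J1 J2
  assume *: "q_ideal J1 \<and> q_ideal J2 \<and> (\<forall>a\<in>J1. \<forall>b\<in>J2. q_mul G I a b = q_zero G I)"
  define A where "A = {f \<in> C. coset f \<in> J1}"
  define B where "B = {f \<in> C. coset f \<in> J2}"
  have A: "ring_ideal A" and B: "ring_ideal B"
    unfolding A_def B_def using * ring_ideal_vimage by auto
  have AB: "fa_mul a b \<in> I" if "a \<in> A" "b \<in> B" for a b
  proof -
    have "q_mul G I (coset a) (coset b) = q_zero G I" using that * by (auto simp: A_def B_def)
    then show ?thesis using that by (simp add: A_def B_def q_mul_coset coset_eq_zero_iff)
  qed
  have "A \<subseteq> I \<or> B \<subseteq> I"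
  proof (rule ccontr)
    assume "\<not> ?thesis"
    then obtain x y where xy: "x \<in> A" "x \<notin> I" "y \<in> B" "y \<notin> I" by blast
    then have "x \<in> C" "y \<in> C" by (auto simp: A_def B_def)
    then obtain a b e f where "a \<in> C" "b \<in> C" "e \<in> C" "f \<in> C"
      and n: "fa_mul (fa_mul (fa_mul a x) b) (fa_mul (fa_mul e y) f) \<notin> I"
      using assms(2) xy by blast
    then have "fa_mul (fa_mul a x) b \<in> A" "fa_mul (fa_mul e y) f \<in> B"
      using A B xy by (auto simp: rng_ideal_def)
    then show False using AB n by blast
  qed
  moreover have "J = {q_zero G I}" if "q_ideal J" "{f \<in> C. coset f \<in> J} \<subseteq> I" for J
  proof -
    have "X = q_zero G I" if X: "X \<in> J" for X
    proof -
      have "X \<in> q_carrier G I" using X \<open>q_ideal J\<close> by (auto simp: rng_ideal_def)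
      then obtain f where "f \<in> C" "X = coset f" by (auto simp: q_carrier_def)
      then show ?thesis using X \<open>{f \<in> C. coset f \<in> J} \<subseteq> I\<close> coset_eq_zero_iff by blast
    qed
    moreover have "q_zero G I \<in> J" using \<open>q_ideal J\<close> by (auto simp: rng_ideal_def)
    ultimately show ?thesis by blast
  qed
  ultimately show "J1 = {q_zero G I} \<or> J2 = {q_zero G I}"
    using * unfolding A_def B_def by blast
qed

end

section \<open>Row-finite k-graphs\<close>

locale kgraph =
  fixes k :: nat and M V :: "'m set" and r s :: "'m \<Rightarrow> 'm"
    and c :: "'m \<Rightarrow> 'm \<Rightarrow> 'm" and d :: "'m \<Rightarrow> nat \<Rightarrow> nat"
  assumes kgraph: "is_kgraph k M V r s c d"
    and row_finite: "row_finite M V r d"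
begin

lemma kgraph_laws:
  shows "V \<subseteq> M" and "\<forall>l\<in>M. r l \<in> V \<and> s l \<in> V" and "\<forall>v\<in>V. r v = v \<and> s v = v"
    and "\<forall>l\<in>M. \<forall>m\<in>M. s l = r m \<longrightarrow> c l m \<in> M \<and> r (c l m) = r l \<and> s (c l m) = s m"
    and "\<forall>l\<in>M. c (r l) l = l \<and> c l (s l) = l"
    and "\<forall>l\<in>M. \<forall>m\<in>M. \<forall>n\<in>M. s l = r m \<and> s m = r n \<longrightarrow> c (c l m) n = c l (c m n)"
    and "\<forall>l\<in>M. \<forall>i\<ge>k. d l i = 0" and "\<forall>v\<in>V. d v = 0"
    and "\<forall>l\<in>M. \<forall>m\<in>M. s l = r m \<longrightarrow> d (c l m) = d l + d m"
  by ((insert kgraph[unfolded is_kgraph_def], elim conjE, assumption)+)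

lemma V_sub: "v \<in> V \<Longrightarrow> v \<in> M" using kgraph_laws by blast
lemma r_V [simp]: "l \<in> M \<Longrightarrow> r l \<in> V" using kgraph_laws by blast
lemma s_V [simp]: "l \<in> M \<Longrightarrow> s l \<in> V" using kgraph_laws by blast
lemma r_vertex [simp]: "v \<in> V \<Longrightarrow> r v = v" using kgraph_laws by blast
lemma s_vertex [simp]: "v \<in> V \<Longrightarrow> s v = v" using kgraph_laws by blast
lemma d_vertex [simp]: "v \<in> V \<Longrightarrow> d v = 0" using kgraph_laws by blast
lemma comp_M [simp]: "l \<in> M \<Longrightarrow> m \<in> M \<Longrightarrow> s l = r m \<Longrightarrow> c l m \<in> M"
  using kgraph_laws by blast
lemma r_comp [simp]: "l \<in> M \<Longrightarrow> m \<in> M \<Longrightarrow> s l = r m \<Longrightarrow> r (c l m) = r l"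
  using kgraph_laws by blast
lemma s_comp [simp]: "l \<in> M \<Longrightarrow> m \<in> M \<Longrightarrow> s l = r m \<Longrightarrow> s (c l m) = s m"
  using kgraph_laws by blast
lemma d_comp [simp]: "l \<in> M \<Longrightarrow> m \<in> M \<Longrightarrow> s l = r m \<Longrightarrow> d (c l m) = d l + d m"
  using kgraph_laws by blast
lemma comp_r [simp]: "l \<in> M \<Longrightarrow> c (r l) l = l" using kgraph_laws by blast
lemma comp_s [simp]: "l \<in> M \<Longrightarrow> c l (s l) = l" using kgraph_laws by blast
lemma comp_assoc: "l \<in> M \<Longrightarrow> m \<in> M \<Longrightarrow> n \<in> M \<Longrightarrow> s l = r m \<Longrightarrow> s m = r n \<Longrightarrow> c (c l m) n = c l (c m n)"
  using kgraph_laws by blast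
lemma d_ge_k: "l \<in> M \<Longrightarrow> i \<ge> k \<Longrightarrow> d l i = 0" using kgraph_laws by blast

lemma factor_ex1:
  assumes "l \<in> M" "d l = p + q"
  shows "\<exists>!x. fst x \<in> M \<and> snd x \<in> M \<and> s (fst x) = r (snd x) \<and>
              c (fst x) (snd x) = l \<and> d (fst x) = p \<and> d (snd x) = q"
proof -
  have "\<forall>l\<in>M. \<forall>p q. d l = p + q \<longrightarrow>
        (\<exists>!x. fst x \<in> M \<and> snd x \<in> M \<and> s (fst x) = r (snd x) \<and>
              c (fst x) (snd x) = l \<and> d (fst x) = p \<and> d (snd x) = q)"
    using kgraph unfolding is_kgraph_def by (elim conjE)
  then show ?thesis using assms by blast
qed

lemma factor:
  assumes "l \<in> M" "p \<le> d l"
  obtains a b where "a \<in> M" "b \<in> M" "s a = r b" "c a b = l" "d a = p" "d b = d l - p"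
proof -
  have "d l = p + (d l - p)" using assms(2) by (auto simp: fun_eq_iff le_fun_def)
  from factor_ex1[OF assms(1) this] that show ?thesis by blast
qed

text \<open>By additivity of \<open>d\<close>, equal degrees of the left factors force equal degrees
  of the right ones, so both pairs are the same factorization.\<close>

lemma comp_cancel:
  assumes "a \<in> M" "b \<in> M" "s a = r b" "a' \<in> M" "b' \<in> M" "s a' = r b'" "c a b = c a' b'" "d a = d a'"
  shows "a = a' \<and> b = b'"
proof -
  have "d a + d b = d a + d b'" using assms by (metis d_comp)
  then have "d b = d b'" by simp
  have "(a, b) = (a', b')"
    using factor_ex1[of "c a b" "d a" "d b"] assms \<open>d b = d b'\<close>
    by (metis comp_M d_comp fst_conv snd_conv)
  then show ?thesis by simp
qed

text \<open>\<open>c (r l) l\<close> and \<open>c l (s l)\<close> both factor \<open>l\<close> into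
  paths of degree zero; uniqueness gives \<open>r l = l\<close>.\<close>

lemma d_zero_vertex: assumes "l \<in> M" "d l = 0" shows "l \<in> V"
proof -
  have "r l = l \<and> l = s l"
    by (rule comp_cancel) (use assms V_sub[of "r l"] V_sub[of "s l"] in auto)
  then show ?thesis using assms r_V by metis
qed

section \<open>Degrees in \<open>N^k\<close> and the path sets \<open>LE n\<close>\<close>

definition NK :: "(nat \<Rightarrow> nat) set" where "NK = {n. \<forall>i\<ge>k. n i = 0}"

lemma d_NK [simp]: "l \<in> M \<Longrightarrow> d l \<in> NK" by (simp add: NK_def d_ge_k)
lemma NK_diff [simp]: "n \<in> NK \<Longrightarrow> n - m \<in> NK" by (simp add: NK_def)
lemma NK_nonzero_iff: "n \<in> NK_nonzero k \<longleftrightarrow> n \<in> NK \<and> n \<noteq> 0" by (auto simp: NK_nonzero_def NK_def)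

abbreviation "LE \<equiv> LE_paths k M r s d"
definition LEv :: "'m \<Rightarrow> (nat \<Rightarrow> nat) \<Rightarrow> 'm set" where "LEv v n = {l \<in> LE n. r l = v}"

lemma LE_M: "l \<in> LE n \<Longrightarrow> l \<in> M" by (simp add: LE_paths_def)
lemma LEvD: "l \<in> LEv v n \<Longrightarrow> l \<in> M" "l \<in> LEv v n \<Longrightarrow> r l = v" "l \<in> LEv v n \<Longrightarrow> l \<in> LE n"
  by (auto simp: LEv_def LE_paths_def)

lemma finite_le_NK: assumes "n \<in> NK" shows "finite {m. m \<le> n}"
proof -
  have "{m. m \<le> n} \<subseteq> {m. \<forall>i. (i \<in> {..<k} \<longrightarrow> m i \<in> {..Max (n ` {..<k})}) \<and> (i \<notin> {..<k} \<longrightarrow> m i = 0)}"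
  proof clarify
    fix m i assume m: "m \<le> n"
    have "m i \<le> Max (n ` {..<k})" if "i < k"
      using that m by (intro order_trans[OF le_funD[OF m] Max_ge]) auto
    moreover have "m i = 0" if "\<not> i < k"
      using that assms le_funD[OF m, of i] by (simp add: NK_def)
    ultimately show "(i \<in> {..<k} \<longrightarrow> m i \<in> {..Max (n ` {..<k})}) \<and> (i \<notin> {..<k} \<longrightarrow> m i = 0)" by simp
  qed
  moreover have "finite {m. \<forall>i. (i \<in> {..<k} \<longrightarrow> m i \<in> {..Max (n ` {..<k})}) \<and> (i \<notin> {..<k} \<longrightarrow> m i = 0)}"
    by (rule finite_set_of_finite_funs) auto
  ultimately show ?thesis by (rule finite_subset)
qed

lemma finite_paths_le:
  assumes "n \<in> NK" "v \<in> V" shows "finite {l \<in> M. r l = v \<and> d l \<le> n}"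
proof -
  have "{l \<in> M. r l = v \<and> d l \<le> n} \<subseteq> (\<Union>m\<in>{m. m \<le> n}. {l \<in> M. r l = v \<and> d l = m})" by auto
  moreover have "finite (\<Union>m\<in>{m. m \<le> n}. {l \<in> M. r l = v \<and> d l = m})"
    using finite_le_NK[OF assms(1)] row_finite assms(2) by (auto simp: row_finite_def)
  ultimately show ?thesis by (rule finite_subset)
qed

lemma finite_LEv: assumes "n \<in> NK" "v \<in> V" shows "finite (LEv v n)"
  by (rule finite_subset[OF _ finite_paths_le[OF assms]]) (auto simp: LEv_def LE_paths_def)

text \<open>Lets the relations indexed by nonzero \<open>n\<close> be extended to
  \<open>n = 0\<close>, where the Cuntz--Krieger sum has one term.\<close>

lemma LEv_zero: assumes "v \<in> V" shows "LEv v 0 = {v}"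
proof -
  have "l = v" if "l \<in> M" "r l = v" "d l \<le> 0" for l
  proof -
    have "d l = 0" using that(3) by (auto simp: fun_eq_iff le_fun_def)
    then have "l \<in> V" using \<open>l \<in> M\<close> by (rule d_zero_vertex[rotated])
    then show ?thesis using that(2) by simp
  qed
  moreover have "\<not> ev i \<le> 0" for i by (auto simp: le_fun_def ev_def)
  ultimately show ?thesis using assms V_sub by (auto simp: LEv_def LE_paths_def)
qed

text \<open>No proper extension of \<open>l\<close> has degree at most \<open>d l\<close>, so the
  maximality condition is vacuous. Paths of equal degree therefore share one
  \<open>LE n\<close>.\<close>

lemma LE_degree [intro]: assumes "l \<in> M" shows "l \<in> LE (d l)"
proof -
  have "\<not> d l + ev i \<le> d l" for i by (auto simp: le_fun_def ev_def intro!: exI[of _ i])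
  then show ?thesis using assms by (simp add: LE_paths_def)
qed

lemma edge_of_degree:
  assumes "l \<in> M" "d l i > 0" obtains a where "a \<in> M" "r a = r l" "d a = ev i"
proof -
  have "ev i \<le> d l" using assms(2) by (auto simp: le_fun_def ev_def)
  from factor[OF assms(1) this] show thesis using that by (metis r_comp)
qed

lemma ev_less: "i < k" if "l \<in> M" "d l i > 0" using that d_ge_k[of l i] by (cases "i < k") auto

text \<open>If \<open>l\<close> were below \<open>n\<close> in a coordinate where \<open>x\<close>
  has positive degree, the first edge of \<open>x\<close> in that direction would extend
  \<open>l\<close> within \<open>n\<close>. Hence the degree of \<open>l\<close> is determined by
  \<open>n\<close> and the whole path \<open>c l x\<close>.\<close>

lemma LE_prefix_degree:
  assumes "l \<in> LE n" "x \<in> M" "s l = r x"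
  shows "d l = (\<lambda>i. min (d (c l x) i) (n i))"
proof
  fix i
  have l: "l \<in> M" "d l \<le> n" using assms(1) by (auto simp: LE_paths_def)
  have dc: "d (c l x) i = d l i + d x i" using l assms by simp
  show "d l i = min (d (c l x) i) (n i)"
  proof (cases "d l i < n i \<and> d x i > 0")
    case True
    then obtain a where "a \<in> M" "r a = r x" "d a = ev i" using edge_of_degree assms(2) by blast
    moreover have "i < k" using ev_less assms(2) True by blast
    moreover have "d l + ev i \<le> n" using True l(2) by (auto simp: le_fun_def ev_def)
    ultimately have False using assms by (auto simp: LE_paths_def)
    then show ?thesis ..
  next
    case False
    then show ?thesis using dc le_funD[OF l(2), of i] by auto
  qed
qed

text \<open>Both prefixes have the degree computed in \<open>LE_prefix_degree\<close>, and prefixes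
  of one degree are unique.\<close>

lemma LE_prefix_unique:
  assumes "l \<in> LE n" "m \<in> LE n" "x \<in> M" "y \<in> M" "s l = r x" "s m = r y" "c l x = c m y"
  shows "l = m \<and> x = y"
proof (rule comp_cancel)
  show "d l = d m"
    unfolding LE_prefix_degree[OF assms(1,3,5)] LE_prefix_degree[OF assms(2,4,6)] assms(7) ..
qed (use assms LE_M in simp_all)

text \<open>An extension of \<open>c l x\<close> within \<open>n\<close> is an extension of
  \<open>x\<close> within \<open>n - d l\<close>. This moves paths of different degrees into a
  common \<open>LE n\<close>.\<close>

lemma comp_LE:
  assumes "l \<in> M" "d l \<le> n" "x \<in> LEv (s l) (n - d l)"
  shows "c l x \<in> LE n"
proof -
  have x: "x \<in> M" "r x = s l" using assms(3) LEvD by auto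
  have dx: "d x \<le> n - d l" using assms(3) by (auto simp: LEv_def LE_paths_def)
  have "d l + d x \<le> n"
  proof (rule le_funI)
    fix i show "(d l + d x) i \<le> n i" using le_funD[OF dx, of i] le_funD[OF assms(2), of i] by simp
  qed
  moreover have "d x + ev i \<le> n - d l" if "d l + d x + ev i \<le> n" for i
  proof (rule le_funI)
    fix j show "(d x + ev i) j \<le> (n - d l) j" using le_funD[OF that, of j] by simp
  qed
  ultimately show ?thesis using assms x by (auto simp: LE_paths_def LEv_def)
qed

lemma comp_left_cancel:
  "l \<in> M \<Longrightarrow> x \<in> M \<Longrightarrow> y \<in> M \<Longrightarrow> s l = r x \<Longrightarrow> s l = r y \<Longrightarrow> c l x = c l y \<Longrightarrow> x = y"
  using comp_cancel by blast

end

section \<open>Relations in the Kumjian--Pask algebra\<close>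

lemma fa_ideal_carrier: "fa_ideal G (fa_carrier G)"
  by (simp add: fa_ideal_def)

text \<open>The carrier itself is one of the ideals intersected, so the family is nonempty and the
  intersection stays inside the carrier.\<close>

lemma fa_ideal_gen_ideal:
  assumes "Rs \<subseteq> fa_carrier G" shows "fa_ideal G (fa_gen_ideal G Rs)"
proof -
  have sub: "fa_gen_ideal G Rs \<subseteq> fa_carrier G"
    unfolding fa_gen_ideal_def using fa_ideal_carrier[of G] assms by blast
  show ?thesis unfolding fa_ideal_def
  proof (intro conjI ballI allI)
    show "fa_gen_ideal G Rs \<subseteq> fa_carrier G" by (rule sub)
  qed (auto simp: fa_gen_ideal_def fa_ideal_def)
qed

lemma fa_gen_ideal_incl: "f \<in> Rs \<Longrightarrow> f \<in> fa_gen_ideal G Rs"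
  by (auto simp: fa_gen_ideal_def)

lemma fa_gen_ideal_least: "fa_ideal G J \<Longrightarrow> Rs \<subseteq> J \<Longrightarrow> fa_gen_ideal G Rs \<subseteq> J"
  by (auto simp: fa_gen_ideal_def)

lemma fa_carrier_gen: "x \<in> G \<Longrightarrow> fa_gen x \<in> fa_carrier G"
  by (simp add: fa_gen_eq_mono_word fa_carrier_mono_word)

locale kp = kgraph k M V r s c d
  for k :: nat and M V :: "'m set" and r s :: "'m \<Rightarrow> 'm"
    and c :: "'m \<Rightarrow> 'm \<Rightarrow> 'm" and d :: "'m \<Rightarrow> nat \<Rightarrow> nat" +
  fixes R :: "'r::comm_ring_1 itself"
begin

abbreviation "gens \<equiv> kp_gens M V d"
definition I :: "('m kpgen list \<Rightarrow> 'r) set" where "I = kp_ideal k M V r s c d"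
definition S :: "'m \<Rightarrow> 'm kpgen list \<Rightarrow> 'r" where "S = kpS d"
definition T :: "'m \<Rightarrow> 'm kpgen list \<Rightarrow> 'r" where "T = kpSst d"
definition P :: "'m \<Rightarrow> 'm kpgen list \<Rightarrow> 'r" where "P = kpP"
abbreviation kp_mul :: "('m kpgen list \<Rightarrow> 'r) \<Rightarrow> ('m kpgen list \<Rightarrow> 'r) \<Rightarrow> 'm kpgen list \<Rightarrow> 'r" (infixl "\<cdot>" 70)
  where "f \<cdot> g \<equiv> fa_mul f g"
abbreviation "Rels \<equiv> kp_rels k M V r s c d :: ('m kpgen list \<Rightarrow> 'r) set"

lemma S_carrier [simp]: "l \<in> M \<Longrightarrow> S l \<in> fa_carrier gens"
  using d_zero_vertex by (auto simp: S_def kpS_def kp_gens_def intro!: fa_carrier_gen)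
lemma T_carrier [simp]: "l \<in> M \<Longrightarrow> T l \<in> fa_carrier gens"
  using d_zero_vertex by (auto simp: T_def kpSst_def kp_gens_def intro!: fa_carrier_gen)
lemma P_carrier [simp]: "v \<in> V \<Longrightarrow> P v \<in> fa_carrier gens"
  by (auto simp: P_def kpP_def kp_gens_def intro!: fa_carrier_gen)

text \<open>Case distinction over the nine families of relations, for checking a property of
  \<open>I\<close> on its generators.\<close>

lemma kp_rels_cases [consumes 1]:
  assumes "f \<in> Rels"
  obtains (PP) v w where "v \<in> V" "w \<in> V" "f = P v \<cdot> P w - (if v = w then P v else 0)"
  | (SS) l m where "l \<in> M" "m \<in> M" "s l = r m" "f = S l \<cdot> S m - S (c l m)"
  | (TT) l m where "l \<in> M" "m \<in> M" "s l = r m" "f = T m \<cdot> T l - T (c l m)"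
  | (PS) l where "l \<in> M" "f = P (r l) \<cdot> S l - S l"
  | (SP) l where "l \<in> M" "f = S l \<cdot> P (s l) - S l"
  | (PT) l where "l \<in> M" "f = P (s l) \<cdot> T l - T l"
  | (TP) l where "l \<in> M" "f = T l \<cdot> P (r l) - T l"
  | (TS) l m n where "n \<in> NK" "n \<noteq> 0" "l \<in> LE n" "m \<in> LE n"
      "f = T l \<cdot> S m - (if l = m then P (s l) else 0)"
  | (CK) v n where "v \<in> V" "n \<in> NK" "n \<noteq> 0" "f = P v - (\<Sum>l\<in>LEv v n. S l \<cdot> T l)"
  using assms unfolding kp_rels_def S_def[symmetric] T_def[symmetric] P_def[symmetric]
    NK_nonzero_iff LEv_def[symmetric]
  apply (elim UnE CollectE exE conjE)
          apply (rule PP; assumption)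
         apply (rule SS; assumption)
        apply (rule TT; assumption)
       apply (rule PS; assumption)
      apply (rule SP; assumption)
     apply (rule PT; assumption)
    apply (rule TP; assumption)
   apply (rule TS; assumption)
  apply (rule CK; assumption)
  done

lemma rels_carrier: "Rels \<subseteq> fa_carrier gens"
proof
  fix f assume "f \<in> Rels"
  then show "f \<in> fa_carrier gens"
    by (cases rule: kp_rels_cases) (auto simp: LE_M LEvD(1) intro!: fa_carrier_diff fa_carrier_sum fa_carrier_mul S_carrier T_carrier)
qed

sublocale fa_quotient gens I
proof
  show "fa_ideal gens I" unfolding I_def kp_ideal_def by (rule fa_ideal_gen_ideal[OF rels_carrier])
qed

abbreviation kp_cong (infix "\<approx>" 50) where "f \<approx> g \<equiv> cong f g"

lemma rel_in_I: "f \<in> Rels \<Longrightarrow> f \<in> I"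
  unfolding I_def kp_ideal_def by (rule fa_gen_ideal_incl)

text \<open>Serves as induction over \<open>I\<close>: a property that cuts out an ideal and holds
  on the relations holds on all of \<open>I\<close>.\<close>

lemma I_least: "fa_ideal gens J \<Longrightarrow> Rels \<subseteq> J \<Longrightarrow> I \<subseteq> J"
  unfolding I_def kp_ideal_def by (rule fa_gen_ideal_least)

lemma S_vertex: "v \<in> V \<Longrightarrow> S v = P v" by (simp add: S_def P_def kpS_def kpP_def)
lemma T_vertex: "v \<in> V \<Longrightarrow> T v = P v" by (simp add: T_def P_def kpSst_def kpP_def)

lemma PP:
  assumes "v \<in> V" "w \<in> V" shows "P v \<cdot> P w \<approx> (if v = w then P v else 0)"
proof -
  have "P v \<cdot> P w - (if v = w then P v else 0) \<in> Rels"
    unfolding kp_rels_def P_def using assms by blast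
  then show ?thesis unfolding cong_def using assms rel_in_I by auto
qed

lemma SS:
  assumes "l \<in> M" "m \<in> M" "s l = r m" shows "S l \<cdot> S m \<approx> S (c l m)"
proof -
  have "S l \<cdot> S m - S (c l m) \<in> Rels"
    unfolding kp_rels_def S_def using assms by blast
  then show ?thesis unfolding cong_def using assms rel_in_I by auto
qed

lemma TT:
  assumes "l \<in> M" "m \<in> M" "s l = r m" shows "T m \<cdot> T l \<approx> T (c l m)"
proof -
  have "T m \<cdot> T l - T (c l m) \<in> Rels"
    unfolding kp_rels_def T_def using assms by blast
  then show ?thesis unfolding cong_def using assms rel_in_I by auto
qed

text \<open>The vertex \<open>r l\<close> is itself a path with \<open>S (r l) = P (r l)\<close>, so
  this relation and the next three are cases of multiplicativity.\<close>

lemma PS: "l \<in> M \<Longrightarrow> P (r l) \<cdot> S l \<approx> S l"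
  using SS[of "r l" l] V_sub[of "r l"] by (simp add: S_vertex)
lemma SP: "l \<in> M \<Longrightarrow> S l \<cdot> P (s l) \<approx> S l"
  using SS[of l "s l"] V_sub[of "s l"] by (simp add: S_vertex)
lemma PT: "l \<in> M \<Longrightarrow> P (s l) \<cdot> T l \<approx> T l"
  using TT[of l "s l"] V_sub[of "s l"] by (simp add: T_vertex)
lemma TP: "l \<in> M \<Longrightarrow> T l \<cdot> P (r l) \<approx> T l"
  using TT[of "r l" l] V_sub[of "r l"] by (simp add: T_vertex)

text \<open>Extends the defining relation to \<open>n = 0\<close>, where only vertices occur and the
  claim is the orthogonality of the \<open>P v\<close>.\<close>

lemma TS_LE:
  assumes "n \<in> NK" "l \<in> LE n" "m \<in> LE n"
  shows "T l \<cdot> S m \<approx> (if l = m then P (s l) else 0)"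
proof (cases "n = 0")
  case True
  have vertex: "x \<in> V" if "x \<in> LE 0" for x
  proof -
    have "r x \<in> V" using that LE_M by simp
    moreover have "x \<in> LEv (r x) 0" using that by (simp add: LEv_def)
    ultimately show ?thesis using LEv_zero by auto
  qed
  have "l \<in> V" "m \<in> V" using vertex assms True by auto
  then show ?thesis using PP[of l m] by (auto simp: S_vertex T_vertex)
next
  case False
  have lm: "l \<in> M" "m \<in> M" using assms LE_M by auto
  have "T l \<cdot> S m - (if l = m then P (s l) else 0) \<in> Rels"
    unfolding kp_rels_def S_def T_def P_def NK_nonzero_iff using assms False by blast
  then show ?thesis unfolding cong_def using lm rel_in_I by auto
qed

lemma CK:
  assumes "v \<in> V" "n \<in> NK"
  shows "P v \<approx> (\<Sum>l\<in>LEv v n. S l \<cdot> T l)"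
proof (cases "n = 0")
  case True
  then show ?thesis using PP[OF assms(1) assms(1)] assms by (simp add: LEv_zero S_vertex T_vertex cong_sym)
next
  case False
  have "P v - (\<Sum>l\<in>LEv v n. S l \<cdot> T l) \<in> Rels"
    unfolding kp_rels_def S_def T_def P_def NK_nonzero_iff LEv_def using assms False by blast
  moreover have "(\<Sum>l\<in>LEv v n. S l \<cdot> T l) \<in> C" by (intro fa_carrier_sum) (simp add: LEvD)
  ultimately show ?thesis unfolding cong_def using rel_in_I assms by simp
qed

lemma cong_mul_left: "f \<approx> f' \<Longrightarrow> g \<in> C \<Longrightarrow> f \<cdot> g \<approx> f' \<cdot> g" by (rule cong_mul) auto
lemma cong_mul_right: "f \<approx> f' \<Longrightarrow> g \<in> C \<Longrightarrow> g \<cdot> f \<approx> g \<cdot> f'" by (rule cong_mul) auto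

text \<open>The product \<open>P v \<cdot> P w\<close>, which vanishes, can be inserted between
  \<open>f\<close> and \<open>g\<close>.\<close>

lemma orthogonal_zero:
  assumes "f \<cdot> P v \<approx> f" "P w \<cdot> g \<approx> g" "v \<in> V" "w \<in> V" "v \<noteq> w" shows "f \<cdot> g \<approx> 0"
proof -
  have C: "f \<in> C" "g \<in> C" using assms cong_carrier by auto
  have "f \<cdot> g \<approx> (f \<cdot> P v) \<cdot> (P w \<cdot> g)" by (rule cong_mul[OF cong_sym[OF assms(1)] cong_sym[OF assms(2)]])
  also have "\<dots> = f \<cdot> (P v \<cdot> P w) \<cdot> g" by (simp add: fa_mul_assoc)
  also have "\<dots> \<approx> f \<cdot> 0 \<cdot> g" using C PP[OF assms(3,4)] assms(5) by (intro cong_mul) auto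
  finally show ?thesis by simp
qed

lemma SS_zero: "l \<in> M \<Longrightarrow> m \<in> M \<Longrightarrow> s l \<noteq> r m \<Longrightarrow> S l \<cdot> S m \<approx> 0"
  using orthogonal_zero[OF SP PS] by simp
lemma TS_zero: "l \<in> M \<Longrightarrow> m \<in> M \<Longrightarrow> r l \<noteq> r m \<Longrightarrow> T l \<cdot> S m \<approx> 0"
  using orthogonal_zero[OF TP PS] by simp

lemma TS_same_degree:
  "l \<in> M \<Longrightarrow> m \<in> M \<Longrightarrow> d l = d m \<Longrightarrow> T l \<cdot> S m \<approx> (if l = m then P (s l) else 0)"
  using TS_LE[of "d l" l m] LE_degree by (metis d_NK)

text \<open>Insert \<open>P (s l)\<close> and expand it by the Cuntz--Krieger relation. The two
  lemmas that follow lengthen \<open>T l\<close> and \<open>S l \<cdot> T m\<close> in the same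
  way.\<close>

lemma S_expand:
  assumes "l \<in> M" "n \<in> NK"
  shows "S l \<approx> (\<Sum>x\<in>LEv (s l) n. S (c l x) \<cdot> T x)"
proof -
  have "S l \<approx> S l \<cdot> P (s l)" using SP assms cong_sym by blast
  also have "\<dots> \<approx> S l \<cdot> (\<Sum>x\<in>LEv (s l) n. S x \<cdot> T x)"
    using assms by (intro cong_mul_right CK) auto
  also have "\<dots> = (\<Sum>x\<in>LEv (s l) n. (S l \<cdot> S x) \<cdot> T x)" by (simp add: fa_mul_sum_right fa_mul_assoc)
  also have "\<dots> \<approx> (\<Sum>x\<in>LEv (s l) n. S (c l x) \<cdot> T x)"
    using assms by (intro cong_sum cong_mul_left SS) (auto simp: LEvD)
  finally show ?thesis .
qed

lemma T_expand:
  assumes "l \<in> M" "n \<in> NK"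
  shows "T l \<approx> (\<Sum>x\<in>LEv (s l) n. S x \<cdot> T (c l x))"
proof -
  have "T l \<approx> P (s l) \<cdot> T l" using PT assms cong_sym by blast
  also have "\<dots> \<approx> (\<Sum>x\<in>LEv (s l) n. S x \<cdot> T x) \<cdot> T l"
    using assms by (intro cong_mul_left CK) auto
  also have "\<dots> = (\<Sum>x\<in>LEv (s l) n. S x \<cdot> (T x \<cdot> T l))" by (simp add: fa_mul_sum_left fa_mul_assoc)
  also have "\<dots> \<approx> (\<Sum>x\<in>LEv (s l) n. S x \<cdot> T (c l x))"
    using assms by (intro cong_sum cong_mul_right TT) (auto simp: LEvD)
  finally show ?thesis .
qed

lemma ST_expand:
  assumes "l \<in> M" "m \<in> M" "s l = s m" "n \<in> NK"
  shows "S l \<cdot> T m \<approx> (\<Sum>x\<in>LEv (s m) n. S (c l x) \<cdot> T (c m x))"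
proof -
  have "S l \<cdot> T m \<approx> S l \<cdot> (\<Sum>x\<in>LEv (s m) n. S x \<cdot> T (c m x))"
    using assms by (intro cong_mul_right T_expand) auto
  also have "\<dots> = (\<Sum>x\<in>LEv (s m) n. (S l \<cdot> S x) \<cdot> T (c m x))" by (simp add: fa_mul_sum_right fa_mul_assoc)
  also have "\<dots> \<approx> (\<Sum>x\<in>LEv (s m) n. S (c l x) \<cdot> T (c m x))"
    using assms by (intro cong_sum cong_mul_left SS) (auto simp: LEvD)
  finally show ?thesis .
qed

text \<open>Both paths are extended into \<open>LE n\<close> for the join \<open>n\<close> of their
  degrees. There distinct paths are orthogonal, so only pairs of extensions that meet in the same
  path survive.\<close>

lemma TS_expand:
  assumes "l \<in> M" "m \<in> M" and n: "n = (\<lambda>i. max (d l i) (d m i))"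
  shows "T l \<cdot> S m \<approx> (\<Sum>x\<in>LEv (s l) (n - d l). \<Sum>y\<in>LEv (s m) (n - d m).
           if c l x = c m y then S x \<cdot> T y else 0)"
proof -
  have NK: "n \<in> NK" using assms d_ge_k by (simp add: NK_def)
  have le: "d l \<le> n" "d m \<le> n" by (auto simp: n le_fun_def)
  have "T l \<cdot> S m \<approx> (\<Sum>x\<in>LEv (s l) (n - d l). S x \<cdot> T (c l x)) \<cdot> (\<Sum>y\<in>LEv (s m) (n - d m). S (c m y) \<cdot> T y)"
    using assms NK by (intro cong_mul T_expand S_expand) auto
  also have "\<dots> = (\<Sum>x\<in>LEv (s l) (n - d l). \<Sum>y\<in>LEv (s m) (n - d m). S x \<cdot> ((T (c l x) \<cdot> S (c m y)) \<cdot> T y))"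
    by (simp add: fa_mul_sum_left fa_mul_sum_right fa_mul_assoc) (rule sum.swap)
  also have "\<dots> \<approx> (\<Sum>x\<in>LEv (s l) (n - d l). \<Sum>y\<in>LEv (s m) (n - d m).
           if c l x = c m y then S x \<cdot> T y else 0)"
  proof (intro cong_sum)
    fix x y assume x: "x \<in> LEv (s l) (n - d l)" and y: "y \<in> LEv (s m) (n - d m)"
    note xy = LEvD[OF x] LEvD[OF y]
    have e: "S x \<cdot> ((T (c l x) \<cdot> S (c m y)) \<cdot> T y) \<approx> S x \<cdot> ((if c l x = c m y then P (s (c l x)) else 0) \<cdot> T y)"
      using xy assms le x y NK by (intro cong_mul_right cong_mul_left TS_LE[of n] comp_LE) auto
    show "S x \<cdot> ((T (c l x) \<cdot> S (c m y)) \<cdot> T y) \<approx> (if c l x = c m y then S x \<cdot> T y else 0)"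
    proof (cases "c l x = c m y")
      case True
      have "s y = s (c l x)" using True xy assms by simp
      then have "S x \<cdot> (P (s (c l x)) \<cdot> T y) \<approx> S x \<cdot> T y"
        using PT[of y] xy by (intro cong_mul_right) auto
      then show ?thesis using e True cong_trans by auto
    next
      case False
      then show ?thesis using e by simp
    qed
  qed
  finally show ?thesis .
qed

section \<open>Homogeneous spanning sets\<close>

abbreviation ST :: "'m \<times> 'm \<Rightarrow> 'm kpgen list \<Rightarrow> 'r" where "ST t \<equiv> S (fst t) \<cdot> T (snd t)"

text \<open>Degrees are taken in the integers because \<open>T l\<close> has degree
  \<open>- dz l\<close>.\<close>

definition dz :: "'m \<Rightarrow> nat \<Rightarrow> int" where "dz l = (\<lambda>i. int (d l i))"

lemma dz_comp [simp]: "l \<in> M \<Longrightarrow> m \<in> M \<Longrightarrow> s l = r m \<Longrightarrow> dz (c l m) = dz l + dz m"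
  by (simp add: dz_def fun_eq_iff)
lemma dz_vertex [simp]: "v \<in> V \<Longrightarrow> dz v = 0" by (simp add: dz_def fun_eq_iff)
lemma dz_eq_iff: "dz l = dz m \<longleftrightarrow> d l = d m" by (simp add: dz_def fun_eq_iff)

definition spanning_pairs :: "(nat \<Rightarrow> int) \<Rightarrow> ('m \<times> 'm) set" where
  "spanning_pairs g = {(l, m). l \<in> M \<and> m \<in> M \<and> s l = s m \<and> dz l = dz m + g}"

text \<open>Spans are taken modulo \<open>I\<close> and indexed by pairs of paths instead of
  elements, so that a representation assigns one coefficient to each pair.\<close>

definition span :: "('m \<times> 'm) set \<Rightarrow> ('m kpgen list \<Rightarrow> 'r) set" where
  "span X = {x. \<exists>A a. finite A \<and> A \<subseteq> X \<and> x \<approx> (\<Sum>t\<in>A. fa_smul (a t) (ST t))}"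

lemma span_cong: "x \<approx> y \<Longrightarrow> y \<in> span X \<Longrightarrow> x \<in> span X"
  unfolding span_def using cong_trans by blast

lemma span_mono: "X \<subseteq> Y \<Longrightarrow> span X \<subseteq> span Y"
  unfolding span_def by blast

lemma span_base: assumes "t \<in> X" "fst t \<in> M" "snd t \<in> M" shows "ST t \<in> span X"
  unfolding span_def using assms by (auto intro!: exI[of _ "{t}"] exI[of _ "\<lambda>_. 1"])

lemma span_ST: "(l, m) \<in> X \<Longrightarrow> l \<in> M \<Longrightarrow> m \<in> M \<Longrightarrow> S l \<cdot> T m \<in> span X"
  using span_base[of "(l, m)"] by simp

lemma span_zero: "0 \<in> span X"
  unfolding span_def by (auto intro!: exI[of _ "{}"])

lemma span_add:
  assumes "x \<in> span X" "y \<in> span X" shows "x + y \<in> span X"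
proof -
  obtain A a where A: "finite A" "A \<subseteq> X" "x \<approx> (\<Sum>t\<in>A. fa_smul (a t) (ST t))"
    using assms(1) by (auto simp: span_def)
  obtain B b where B: "finite B" "B \<subseteq> X" "y \<approx> (\<Sum>t\<in>B. fa_smul (b t) (ST t))"
    using assms(2) by (auto simp: span_def)
  \<comment> \<open>Coefficients are extended by zero to the union of the two index sets.\<close>
  define a' b' where "a' t = (if t \<in> A then a t else 0)" and "b' t = (if t \<in> B then b t else 0)" for t
  have "(\<Sum>t\<in>A. fa_smul (a t) (ST t)) = (\<Sum>t\<in>A \<union> B. fa_smul (a' t) (ST t))"
    using A B by (intro sum.mono_neutral_cong_left) (auto simp: a'_def)
  moreover have "(\<Sum>t\<in>B. fa_smul (b t) (ST t)) = (\<Sum>t\<in>A \<union> B. fa_smul (b' t) (ST t))"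
    using A B by (intro sum.mono_neutral_cong_left) (auto simp: b'_def)
  ultimately have "x + y \<approx> (\<Sum>t\<in>A \<union> B. fa_smul (a' t + b' t) (ST t))"
    using cong_add[OF A(3) B(3)] by (simp add: fa_smul_add_scalar sum.distrib)
  then show ?thesis unfolding span_def using A B
    by (intro CollectI exI[of _ "A \<union> B"] exI[of _ "\<lambda>t. a' t + b' t"]) auto
qed

lemma span_smul: assumes "x \<in> span X" shows "fa_smul a x \<in> span X"
proof -
  obtain A b where A: "finite A" "A \<subseteq> X" "x \<approx> (\<Sum>t\<in>A. fa_smul (b t) (ST t))"
    using assms(1) by (auto simp: span_def)
  have "fa_smul a x \<approx> (\<Sum>t\<in>A. fa_smul (a * b t) (ST t))"
    using cong_smul[OF A(3), of a] by (simp add: fa_smul_sum fa_smul_smul)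
  then show ?thesis unfolding span_def using A
    by (intro CollectI exI[of _ A] exI[of _ "\<lambda>t. a * b t"]) auto
qed

lemma span_sum: "(\<And>x. x \<in> A \<Longrightarrow> f x \<in> span X) \<Longrightarrow> sum f A \<in> span X"
  by (induction A rule: infinite_finite_induct) (auto intro: span_zero span_add)

lemma mul_mem_span:
  assumes "x \<in> span X" "u \<in> C" "\<And>t. t \<in> X \<Longrightarrow> u \<cdot> ST t \<in> span Y"
  shows "u \<cdot> x \<in> span Y"
proof -
  obtain A a where A: "finite A" "A \<subseteq> X" "x \<approx> (\<Sum>t\<in>A. fa_smul (a t) (ST t))"
    using assms(1) by (auto simp: span_def)
  have "u \<cdot> x \<approx> u \<cdot> (\<Sum>t\<in>A. fa_smul (a t) (ST t))"
    using A assms(2) by (intro cong_mul_right)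
  also have "\<dots> = (\<Sum>t\<in>A. fa_smul (a t) (u \<cdot> ST t))"
    by (simp add: fa_mul_sum_right fa_mul_smul_right)
  finally show ?thesis
    using A assms(3) by (elim span_cong) (intro span_sum span_smul, blast)
qed

lemma S_mul_span:
  assumes l: "l \<in> M" and t: "t \<in> spanning_pairs g" shows "S l \<cdot> ST t \<in> span (spanning_pairs (dz l + g))"
proof -
  obtain a b where ab: "t = (a, b)" "a \<in> M" "b \<in> M" "s a = s b" "dz a = dz b + g"
    using t by (auto simp: spanning_pairs_def)
  show ?thesis
  proof (cases "s l = r a")
    case True
    have "S l \<cdot> ST t = (S l \<cdot> S a) \<cdot> T b" by (simp add: ab fa_mul_assoc)
    also have "\<dots> \<approx> ST (c l a, b)" using True ab l by (auto intro!: cong_mul_left SS)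
    finally show ?thesis using True ab l
      by (elim span_cong) (intro span_base, auto simp: spanning_pairs_def algebra_simps)
  next
    case False
    have "S l \<cdot> ST t = (S l \<cdot> S a) \<cdot> T b" by (simp add: ab fa_mul_assoc)
    also have "\<dots> \<approx> 0 \<cdot> T b" using False ab l by (intro cong_mul_left SS_zero) auto
    finally show ?thesis using span_cong span_zero by auto
  qed
qed

text \<open>\<open>TS_expand\<close> turns \<open>T l \<cdot> S a\<close> into terms
  \<open>S x \<cdot> T y\<close> with \<open>c l x = c a y\<close>. Comparing the degrees of both
  factorizations yields the degree of the new pair \<open>(x, c b y)\<close>.\<close>

lemma T_mul_span:
  assumes l: "l \<in> M" and t: "t \<in> spanning_pairs g" shows "T l \<cdot> ST t \<in> span (spanning_pairs (- dz l + g))"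
proof -
  obtain a b where ab: "t = (a, b)" "a \<in> M" "b \<in> M" "s a = s b" "dz a = dz b + g"
    using t by (auto simp: spanning_pairs_def)
  define n where "n = (\<lambda>i. max (d l i) (d a i))"
  have "T l \<cdot> ST t = (T l \<cdot> S a) \<cdot> T b" by (simp add: ab fa_mul_assoc)
  also have "\<dots> \<approx> (\<Sum>x\<in>LEv (s l) (n - d l). \<Sum>y\<in>LEv (s a) (n - d a).
           if c l x = c a y then S x \<cdot> T y else 0) \<cdot> T b"
    using ab l by (intro cong_mul_left TS_expand n_def) auto
  also have "\<dots> = (\<Sum>x\<in>LEv (s l) (n - d l). \<Sum>y\<in>LEv (s a) (n - d a).
           (if c l x = c a y then S x \<cdot> T y else 0) \<cdot> T b)"
    by (simp add: fa_mul_sum_left)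
  finally have e: "T l \<cdot> ST t \<approx> \<dots>" .
  show ?thesis
  proof (rule span_cong[OF e], intro span_sum)
    fix x y assume x: "x \<in> LEv (s l) (n - d l)" and y: "y \<in> LEv (s a) (n - d a)"
    note xy = LEvD[OF x] LEvD[OF y]
    show "(if c l x = c a y then S x \<cdot> T y else 0) \<cdot> T b \<in> span (spanning_pairs (- dz l + g))"
    proof (cases "c l x = c a y")
      case True
      then have "s x = s y" using xy l ab by (metis s_comp)
      have "dz l + dz x = dz a + dz y" using True xy l ab by (metis dz_comp)
      then have "dz x = dz (c b y) + (- dz l + g)" using xy ab by (simp add: algebra_simps)
      then have p: "(x, c b y) \<in> spanning_pairs (- dz l + g)"
        using xy ab \<open>s x = s y\<close> by (simp add: spanning_pairs_def)
      have "(S x \<cdot> T y) \<cdot> T b = S x \<cdot> (T y \<cdot> T b)" by (simp add: fa_mul_assoc)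
      also have "\<dots> \<approx> ST (x, c b y)" using xy ab by (auto intro!: cong_mul_right TT)
      finally show ?thesis using True span_cong span_ST[OF p] xy ab by simp
    qed (simp add: span_zero)
  qed
qed

section \<open>Degrees of words and the spanning theorem\<close>

primrec gdeg :: "'m kpgen \<Rightarrow> nat \<Rightarrow> int" where
  "gdeg (Pg v) = 0"
| "gdeg (Sg l) = dz l"
| "gdeg (Sstg l) = - dz l"

definition wdeg :: "'m kpgen list \<Rightarrow> nat \<Rightarrow> int" where "wdeg w = sum_list (map gdeg w)"

lemma wdeg_simps [simp]: "wdeg [] = 0" "wdeg (x # w) = gdeg x + wdeg w" "wdeg (u @ w) = wdeg u + wdeg w"
  by (simp_all add: wdeg_def)

text \<open>A vertex generator equals \<open>S v\<close>, so only two kinds of letters have to be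
  considered.\<close>

lemma gens_cases:
  assumes "x \<in> gens"
  obtains l where "l \<in> M" "fa_gen x = S l" "gdeg x = dz l" | l where "l \<in> M" "fa_gen x = T l" "gdeg x = - dz l"
proof -
  consider v where "v \<in> V" "x = Pg v" | l where "l \<in> M" "d l \<noteq> 0" "x = Sg l" | l where "l \<in> M" "d l \<noteq> 0" "x = Sstg l"
    using assms by (auto simp: kp_gens_def)
  then show thesis
  proof cases
    case 1 then show thesis using that(1)[of v] V_sub by (simp add: S_def kpS_def)
  next
    case 2 then show thesis using that(1)[of l] by (simp add: S_def kpS_def)
  next
    case 3 then show thesis using that(2)[of l] by (simp add: T_def kpSst_def)
  qed
qed

text \<open>Single letters are completed by a vertex as the missing leg; longer words are built by
  multiplying letters on from the left, which maps spanning products to spans of the shifted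
  degree.\<close>

lemma word_span:
  assumes "w \<noteq> []" "set w \<subseteq> gens"
  shows "mono_word w \<in> span (spanning_pairs (wdeg w))"
  using assms
proof (induction w rule: list_nonempty_induct)
  case (single x)
  then have "x \<in> gens" by simp
  then show ?case
  proof (cases rule: gens_cases)
    case (1 l)
    have "S l \<approx> ST (l, s l)" using cong_sym[OF SP[OF 1(1)]] 1 by (simp add: T_vertex)
    moreover have "ST (l, s l) \<in> span (spanning_pairs (dz l))"
      using 1 V_sub[of "s l"] by (intro span_base) (auto simp: spanning_pairs_def)
    moreover have "wdeg [x] = dz l" using 1 by simp
    ultimately show ?thesis using 1(2) by (metis fa_gen_eq_mono_word span_cong)
  next
    case (2 l)
    have "T l \<approx> ST (s l, l)" using cong_sym[OF PT[OF 2(1)]] 2 by (simp add: S_vertex)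
    moreover have "ST (s l, l) \<in> span (spanning_pairs (- dz l))"
      using 2 V_sub[of "s l"] by (intro span_base) (auto simp: spanning_pairs_def)
    moreover have "wdeg [x] = - dz l" using 2 by simp
    ultimately show ?thesis using 2(2) by (metis fa_gen_eq_mono_word span_cong)
  qed
next
  case (cons x w)
  then have IH: "mono_word w \<in> span (spanning_pairs (wdeg w))" by simp
  have e: "mono_word (x # w) = fa_gen x \<cdot> mono_word w" by (simp add: fa_gen_eq_mono_word mono_word_mul)
  have "x \<in> gens" using cons by simp
  then show ?case unfolding e
  proof (cases rule: gens_cases)
    case (1 l)
    then show "fa_gen x \<cdot> mono_word w \<in> span (spanning_pairs (wdeg (x # w)))"
      using mul_mem_span[OF IH _ S_mul_span[OF 1(1)]] by simp
  next
    case (2 l)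
    then show "fa_gen x \<cdot> mono_word w \<in> span (spanning_pairs (wdeg (x # w)))"
      using mul_mem_span[OF IH _ T_mul_span[OF 2(1)]] by simp
  qed
qed

definition homog :: "(nat \<Rightarrow> int) \<Rightarrow> ('m kpgen list \<Rightarrow> 'r) \<Rightarrow> bool" where
  "homog g f \<longleftrightarrow> (\<forall>w. f w \<noteq> 0 \<longrightarrow> wdeg w = g)"

lemma homog_span:
  assumes "x \<in> C" "homog g x" shows "x \<in> span (spanning_pairs g)"
proof -
  have fin: "finite {w. x w \<noteq> 0}" using assms by (simp add: fa_carrier_def)
  have "x = (\<Sum>w\<in>{w. x w \<noteq> 0}. fa_smul (x w) (mono_word w))"
    by (rule fa_eq_sum_mono_word[OF fin]) simp
  also have "\<dots> \<in> span (spanning_pairs g)"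
  proof (intro span_sum span_smul)
    fix w assume "w \<in> {w. x w \<noteq> 0}"
    then have "w \<noteq> []" "set w \<subseteq> gens" "wdeg w = g" using assms by (auto simp: fa_carrier_def homog_def)
    then show "mono_word w \<in> span (spanning_pairs g)" using word_span by blast
  qed
  finally show ?thesis .
qed

text \<open>Lengthening both legs of a pair by the same path keeps its degree, and
  \<open>ST_expand\<close> can choose these paths so that all second legs end up in one
  \<open>LE n\<close>.\<close>

lemma span_LE:
  assumes "x \<in> span (spanning_pairs g)"
  obtains n where "n \<in> NK" "x \<in> span {t \<in> spanning_pairs g. snd t \<in> LE n}"
proof -
  obtain A a where A: "finite A" "A \<subseteq> spanning_pairs g" "x \<approx> (\<Sum>t\<in>A. fa_smul (a t) (ST t))"
    using assms(1) by (auto simp: span_def)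
  \<comment> \<open>A common upper bound for the degrees of the second legs; the sum also covers
    empty \<open>A\<close>.\<close>
  define n where "n = (\<lambda>i. \<Sum>t\<in>A. d (snd t) i)"
  have AM: "fst t \<in> M" "snd t \<in> M" "s (fst t) = s (snd t)" "dz (fst t) = dz (snd t) + g" if "t \<in> A" for t
    using that A(2) by (auto simp: spanning_pairs_def)
  have n: "n \<in> NK" using AM d_ge_k by (simp add: NK_def n_def)
  have "ST t \<in> span {t \<in> spanning_pairs g. snd t \<in> LE n}" if t: "t \<in> A" for t
  proof (rule span_cong[OF ST_expand])
    show "(\<Sum>x\<in>LEv (s (snd t)) (n - d (snd t)). S (c (fst t) x) \<cdot> T (c (snd t) x)) \<in> span {t \<in> spanning_pairs g. snd t \<in> LE n}"
    proof (rule span_sum)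
      fix x assume x: "x \<in> LEv (s (snd t)) (n - d (snd t))"
      have "d (snd t) \<le> n" using A t by (auto simp: le_fun_def n_def intro!: member_le_sum)
      then have "c (snd t) x \<in> LE n" using comp_LE[OF _ _ x] AM[OF t] by blast
      moreover have "(c (fst t) x, c (snd t) x) \<in> spanning_pairs g"
        using AM[OF t] LEvD[OF x] by (simp add: spanning_pairs_def algebra_simps)
      ultimately have "ST (c (fst t) x, c (snd t) x) \<in> span {t \<in> spanning_pairs g. snd t \<in> LE n}"
        by (intro span_base) (auto simp: spanning_pairs_def)
      then show "S (c (fst t) x) \<cdot> T (c (snd t) x) \<in> span {t \<in> spanning_pairs g. snd t \<in> LE n}" by simp
    qed
  qed (use AM[OF t] n in auto)
  then have "x \<in> span {t \<in> spanning_pairs g. snd t \<in> LE n}"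
    by (intro span_cong[OF A(3)] span_sum span_smul)
  then show thesis using that n by blast
qed

text \<open>Once all second legs lie in one \<open>LE n\<close>, compressing by the two legs of a
  pair \<open>t\<close> kills every other term and isolates the coefficient of
  \<open>t\<close>.\<close>

lemma homog_compress:
  assumes "x \<in> C" "homog g x" "x \<notin> I"
  obtains l m a where "l \<in> M" "m \<in> M" "s l = s m" "dz l = dz m + g"
    "T l \<cdot> x \<cdot> S m \<approx> fa_smul a (P (s m))" "fa_smul a (P (s m)) \<notin> I"
proof -
  obtain n where n: "n \<in> NK" "x \<in> span {t \<in> spanning_pairs g. snd t \<in> LE n}"
    using span_LE[OF homog_span] assms by blast
  then obtain A a where A: "finite A" "A \<subseteq> {t \<in> spanning_pairs g. snd t \<in> LE n}"
    and x: "x \<approx> (\<Sum>t\<in>A. fa_smul (a t) (ST t))" by (auto simp: span_def)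
  have AM: "fst t \<in> M" "snd t \<in> M" "s (fst t) = s (snd t)" "dz (fst t) = dz (snd t) + g" "snd t \<in> LE n" if "t \<in> A" for t
    using that A(2) by (auto simp: spanning_pairs_def)
  \<comment> \<open>If every \<open>a t\<close> annihilated its vertex idempotent modulo
    \<open>I\<close>, each term, and hence \<open>x\<close>, would lie in \<open>I\<close>, because
    \<open>S (fst t)\<close> absorbs that idempotent.\<close>
  have "\<exists>t\<in>A. fa_smul (a t) (P (s (snd t))) \<notin> I"
  proof (rule ccontr)
    assume neg: "\<not> ?thesis"
    have "fa_smul (a t) (ST t) \<in> I" if t: "t \<in> A" for t
    proof -
      have "S (fst t) \<cdot> (fa_smul (a t) (P (s (snd t)))) \<cdot> T (snd t) \<in> I"
        using AM[OF t] neg t by (intro I_mul_right I_mul_left) auto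
      moreover have "S (fst t) \<cdot> (fa_smul (a t) (P (s (snd t)))) \<cdot> T (snd t)
          = fa_smul (a t) (S (fst t) \<cdot> P (s (fst t)) \<cdot> T (snd t))"
        using AM[OF t] by (simp add: fa_mul_smul_left fa_mul_smul_right)
      moreover have "\<dots> \<approx> fa_smul (a t) (ST t)"
        using AM[OF t] by (intro cong_smul cong_mul_left SP) auto
      ultimately show ?thesis using cong_in_I_iff by simp
    qed
    then have "(\<Sum>t\<in>A. fa_smul (a t) (ST t)) \<in> I" by (rule I_sum)
    then show False using cong_in_I_iff[OF x] assms(3) by simp
  qed
  then obtain t where t: "t \<in> A" "fa_smul (a t) (P (s (snd t))) \<notin> I" by blast
  define l m where "l = fst t" and "m = snd t"
  note lm = AM[OF t(1), folded l_def m_def]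
  have "T l \<cdot> x \<cdot> S m \<approx> T l \<cdot> (\<Sum>t\<in>A. fa_smul (a t) (ST t)) \<cdot> S m"
    using lm x by (intro cong_mul_left cong_mul_right) auto
  also have "\<dots> = (\<Sum>u\<in>A. fa_smul (a u) ((T l \<cdot> S (fst u)) \<cdot> (T (snd u) \<cdot> S m)))"
    by (simp add: fa_mul_sum_left fa_mul_sum_right fa_mul_smul_left fa_mul_smul_right fa_mul_assoc)
  also have "\<dots> \<approx> (\<Sum>u\<in>A. if u = t then fa_smul (a t) (P (s m)) else 0)"
  proof (rule cong_sum)
    fix u assume u: "u \<in> A"
    note um = AM[OF u]
    have e: "T (snd u) \<cdot> S m \<approx> (if snd u = m then P (s (snd u)) else 0)"
      using n um lm by (intro TS_LE) auto
    show "fa_smul (a u) ((T l \<cdot> S (fst u)) \<cdot> (T (snd u) \<cdot> S m)) \<approx> (if u = t then fa_smul (a t) (P (s m)) else 0)"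
    proof (cases "snd u = m")
      case False
      then have "fa_smul (a u) ((T l \<cdot> S (fst u)) \<cdot> (T (snd u) \<cdot> S m)) \<approx> fa_smul (a u) ((T l \<cdot> S (fst u)) \<cdot> 0)"
        using e um lm by (intro cong_smul cong_mul_right) auto
      then show ?thesis using False m_def by auto
    next
      case True
      \<comment> \<open>Homogeneity enters here: equal second legs and the common degree
        \<open>g\<close> force first legs of equal degree, so these are orthogonal unless
        equal.\<close>
      have "dz l = dz (fst u)" using um(4) lm(4) True by simp
      then have e2: "T l \<cdot> S (fst u) \<approx> (if l = fst u then P (s l) else 0)"
        unfolding dz_eq_iff using um(1) lm(1) by (intro TS_same_degree)
      have eq: "u = t \<longleftrightarrow> l = fst u" using True l_def m_def by (auto simp: prod_eq_iff)
      show ?thesis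
      proof (cases "l = fst u")
        case False
        then have "fa_smul (a u) ((T l \<cdot> S (fst u)) \<cdot> (T (snd u) \<cdot> S m)) \<approx> fa_smul (a u) (0 \<cdot> (T (snd u) \<cdot> S m))"
          using e2 um lm by (intro cong_smul cong_mul_left) auto
        then show ?thesis using False eq by auto
      next
        case l: True
        have "(T l \<cdot> S (fst u)) \<cdot> (T (snd u) \<cdot> S m) \<approx> P (s m) \<cdot> P (s m)"
          using e e2 l True lm by (intro cong_mul) auto
        also have "\<dots> \<approx> P (s m)" using PP[of "s m" "s m"] lm by simp
        finally have "fa_smul (a u) ((T l \<cdot> S (fst u)) \<cdot> (T (snd u) \<cdot> S m)) \<approx> fa_smul (a u) (P (s m))"
          by (rule cong_smul)
        then show ?thesis using eq l by simp
      qed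
    qed
  qed
  also have "\<dots> = fa_smul (a t) (P (s m))" using A t by simp
  finally show thesis using that[OF lm(1,2,3,4)] t(2) m_def by blast
qed

section \<open>Grading and leading components\<close>

definition comp :: "(nat \<Rightarrow> int) \<Rightarrow> ('m kpgen list \<Rightarrow> 'r) \<Rightarrow> 'm kpgen list \<Rightarrow> 'r" where
  "comp g f = (\<lambda>w. if wdeg w = g then f w else 0)"

lemma comp_carrier [simp]: "f \<in> C \<Longrightarrow> comp g f \<in> C"
  by (erule fa_carrierI_supp[OF _ fa_carrier_zero]) (auto simp: comp_def split: if_splits)

lemma comp_zero [simp]: "comp g 0 = 0" by (simp add: comp_def fun_eq_iff)
lemma comp_add: "comp g (f + h) = comp g f + comp g h" by (simp add: comp_def fun_eq_iff)
lemma comp_smul: "comp g (fa_smul a f) = fa_smul a (comp g f)"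
  by (simp add: comp_def fa_smul_def fun_eq_iff)
lemma comp_sum: "comp g (sum f A) = (\<Sum>x\<in>A. comp g (f x))"
  by (induction A rule: infinite_finite_induct)
     (simp_all only: sum.infinite sum.empty sum.insert comp_zero comp_add not_False_eq_True)

lemma homog_comp: "homog g (comp g f)" by (simp add: homog_def comp_def)
lemma comp_homog: "homog g f \<Longrightarrow> comp h f = (if h = g then f else 0)"
  by (auto simp: homog_def comp_def fun_eq_iff)

lemma homog_zero [simp]: "homog g 0" by (simp add: homog_def)
lemma homog_diff: "homog g f \<Longrightarrow> homog g h \<Longrightarrow> homog g (f - h)"
  unfolding homog_def by (metis diff_self minus_apply)
lemma homog_mul:
  assumes "homog g f" "homog h f'" shows "homog (g + h) (f \<cdot> f')"
  unfolding homog_def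
proof (intro allI impI)
  fix w assume "(f \<cdot> f') w \<noteq> 0"
  then obtain p where "p \<in> splits w" "f (fst p) * f' (snd p) \<noteq> 0"
    unfolding fa_mul_splits by (meson sum.not_neutral_contains_not_neutral)
  moreover from this have "f (fst p) \<noteq> 0" "f' (snd p) \<noteq> 0" by auto
  ultimately show "wdeg w = g + h" using assms by (auto simp: homog_def splits_def)
qed
lemma homog_sum: "(\<And>x. x \<in> A \<Longrightarrow> homog g (f x)) \<Longrightarrow> homog g (sum f A)"
  unfolding homog_def sum_fun_apply by (meson sum.not_neutral_contains_not_neutral)
lemma homog_P [simp]: "homog 0 (P v)"
  by (auto simp: homog_def P_def kpP_def fa_gen_def split: if_splits)
lemma homog_S [simp]: "homog (dz l) (S l)"
  by (auto simp: homog_def S_def kpS_def fa_gen_def dz_def zero_fun_def split: if_splits)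
lemma homog_T [simp]: "homog (- dz l) (T l)"
  by (auto simp: homog_def T_def kpSst_def fa_gen_def dz_def fun_eq_iff split: if_splits)

text \<open>In a split of \<open>w\<close> on which \<open>u\<close> does not vanish, the first
  piece has degree \<open>e\<close>, so the second has degree \<open>h - e\<close> exactly when
  \<open>w\<close> has degree \<open>h\<close>.\<close>

lemma comp_mul_homog_left:
  assumes "homog e u" shows "comp h (u \<cdot> x) = u \<cdot> comp (h - e) x"
proof
  fix w
  have *: "u (fst p) * comp (h - e) x (snd p) = (if wdeg w = h then u (fst p) * x (snd p) else 0)"
    if "p \<in> splits w" for p
  proof (cases "u (fst p) = 0")
    case False
    then have "wdeg (fst p) = e" using assms by (auto simp: homog_def)
    moreover have "wdeg w = wdeg (fst p) + wdeg (snd p)" using that by (auto simp: splits_def)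
    ultimately have "wdeg (snd p) = h - e \<longleftrightarrow> wdeg w = h" by (auto simp: algebra_simps)
    then show ?thesis by (simp add: comp_def)
  qed simp
  have "(u \<cdot> comp (h - e) x) w = (\<Sum>p\<in>splits w. if wdeg w = h then u (fst p) * x (snd p) else 0)"
    unfolding fa_mul_splits by (rule sum.cong[OF refl *])
  then show "comp h (u \<cdot> x) w = (u \<cdot> comp (h - e) x) w"
    by (simp add: comp_def fa_mul_splits)
qed

lemma comp_mul_homog_right:
  assumes "homog e u" shows "comp h (x \<cdot> u) = comp (h - e) x \<cdot> u"
proof
  fix w
  have *: "comp (h - e) x (fst p) * u (snd p) = (if wdeg w = h then x (fst p) * u (snd p) else 0)"
    if "p \<in> splits w" for p
  proof (cases "u (snd p) = 0")
    case False
    then have "wdeg (snd p) = e" using assms by (auto simp: homog_def)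
    moreover have "wdeg w = wdeg (fst p) + wdeg (snd p)" using that by (auto simp: splits_def)
    ultimately have "wdeg (fst p) = h - e \<longleftrightarrow> wdeg w = h" by (auto simp: algebra_simps)
    then show ?thesis by (simp add: comp_def)
  qed simp
  have "(comp (h - e) x \<cdot> u) w = (\<Sum>p\<in>splits w. if wdeg w = h then x (fst p) * u (snd p) else 0)"
    unfolding fa_mul_splits by (rule sum.cong[OF refl *])
  then show "comp h (x \<cdot> u) w = (comp (h - e) x \<cdot> u) w"
    by (simp add: comp_def fa_mul_splits)
qed

definition degs :: "('m kpgen list \<Rightarrow> 'r) \<Rightarrow> (nat \<Rightarrow> int) set" where
  "degs f = wdeg ` {w. f w \<noteq> 0}"

lemma finite_degs: "f \<in> C \<Longrightarrow> finite (degs f)" by (simp add: degs_def fa_carrier_def)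

lemma comp_outside_degs: "g \<notin> degs f \<Longrightarrow> comp g f = 0"
  by (rule ext) (auto simp: comp_def degs_def)

lemma sum_comp: assumes "f \<in> C" shows "f = (\<Sum>g\<in>degs f. comp g f)"
proof
  fix w
  have "(\<Sum>g\<in>degs f. comp g f) w = (\<Sum>g\<in>degs f. if wdeg w = g then f w else 0)"
    by (simp add: sum_fun_apply comp_def)
  also have "\<dots> = (if wdeg w \<in> degs f then f w else 0)" using finite_degs[OF assms] by simp
  also have "\<dots> = f w" by (auto simp: degs_def)
  finally show "f w = (\<Sum>g\<in>degs f. comp g f) w" by simp
qed

lemma comp_mul:
  assumes "f \<in> C" shows "comp h (f \<cdot> x) = (\<Sum>g\<in>degs f. comp g f \<cdot> comp (h - g) x)"
proof -
  have "comp h (f \<cdot> x) = comp h ((\<Sum>g\<in>degs f. comp g f) \<cdot> x)" using sum_comp[OF assms] by simp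
  also have "\<dots> = (\<Sum>g\<in>degs f. comp g f \<cdot> comp (h - g) x)"
    by (simp add: fa_mul_sum_left comp_sum comp_mul_homog_left[OF homog_comp])
  finally show ?thesis .
qed

lemma comp_mul':
  assumes "x \<in> C" shows "comp h (f \<cdot> x) = (\<Sum>g\<in>degs x. comp (h - g) f \<cdot> comp g x)"
proof -
  have "comp h (f \<cdot> x) = comp h (f \<cdot> (\<Sum>g\<in>degs x. comp g x))" using sum_comp[OF assms] by simp
  also have "\<dots> = (\<Sum>g\<in>degs x. comp (h - g) f \<cdot> comp g x)"
    by (simp add: fa_mul_sum_right comp_sum comp_mul_homog_right[OF homog_comp])
  finally show ?thesis .
qed

lemma rel_homog:
  assumes "f \<in> Rels" shows "\<exists>g. homog g f"
  using assms
proof (cases rule: kp_rels_cases)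
  case (PP v w)
  have "homog 0 (P v \<cdot> P w)" using homog_mul[OF homog_P homog_P] by simp
  then have "homog 0 f" unfolding PP(3) by (intro homog_diff) auto
  then show ?thesis by blast
next
  case (SS l m)
  then have "homog (dz l + dz m) f" using homog_S[of "c l m"] by (auto intro!: homog_diff homog_mul)
  then show ?thesis by blast
next
  case (TT l m)
  have "homog (- dz m + - dz l) (T (c l m))" using homog_T[of "c l m"] TT by (simp add: algebra_simps)
  then have "homog (- dz m + - dz l) f" unfolding TT(4) by (intro homog_diff homog_mul homog_T)
  then show ?thesis by blast
next
  case (PS l)
  then have "homog (0 + dz l) f" by (simp only: PS, intro homog_diff homog_mul, simp_all)
  then show ?thesis by blast
next
  case (SP l)
  then have "homog (dz l + 0) f" by (simp only: SP, intro homog_diff homog_mul, simp_all)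
  then show ?thesis by blast
next
  case (PT l)
  then have "homog (0 + - dz l) f" by (simp only: PT, intro homog_diff homog_mul, simp_all)
  then show ?thesis by blast
next
  case (TP l)
  then have "homog (- dz l + 0) f" by (simp only: TP, intro homog_diff homog_mul, simp_all)
  then show ?thesis by blast
next
  case (TS l m n)
  have "homog (- dz l + dz m) (T l \<cdot> S m)" by (intro homog_mul) simp_all
  then have "homog (- dz l + dz m) f" unfolding TS by (intro homog_diff) auto
  then show ?thesis by blast
next
  case (CK v n)
  have "homog 0 (S l \<cdot> T l)" for l using homog_mul[OF homog_S homog_T, of l l] by simp
  then have "homog 0 f" unfolding CK by (intro homog_diff homog_sum homog_P)
  then show ?thesis by blast
qed

text \<open>The relations are homogeneous, so \<open>I\<close> is graded: the elements of
  \<open>I\<close> with all components in \<open>I\<close> form an ideal containing the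
  relations.\<close>

lemma comp_I: assumes "f \<in> I" shows "comp g f \<in> I"
proof -
  let ?J = "{f \<in> I. \<forall>g. comp g f \<in> I}"
  have "fa_ideal gens ?J"
    unfolding fa_ideal_def
  proof (intro conjI ballI allI)
    fix f h assume "f \<in> ?J" "h \<in> C"
    then show "f \<cdot> h \<in> ?J" "h \<cdot> f \<in> ?J"
      by (auto simp: comp_mul[of h] comp_mul'[of h] I_mul_left I_mul_right intro!: I_sum)
  qed (auto simp: I_sub I_add I_smul comp_add comp_smul)
  moreover have "Rels \<subseteq> ?J"
  proof
    fix f assume f: "f \<in> Rels"
    then obtain e where "homog e f" using rel_homog by blast
    then show "f \<in> ?J" using rel_in_I[OF f] comp_homog by auto
  qed
  ultimately show ?thesis using I_least assms by blast
qed

section \<open>The lexicographic order on degrees and leading components\<close>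

definition lexpos :: "(nat \<Rightarrow> int) \<Rightarrow> bool" where
  "lexpos g \<longleftrightarrow> (\<exists>i. g i > 0 \<and> (\<forall>j<i. g j = 0))"

text \<open>The sign of the first nonzero coordinate decides; such a coordinate exists because the
  index set is well-ordered.\<close>

lemma lexpos_total: assumes "g \<noteq> 0" shows "lexpos g \<or> lexpos (- g)"
proof -
  have ex: "\<exists>i. g i \<noteq> 0" using assms by (auto simp: fun_eq_iff)
  define i where "i = (LEAST i. g i \<noteq> 0)"
  have "g i \<noteq> 0" unfolding i_def using ex by (rule LeastI_ex)
  moreover have "g j = 0" if "j < i" for j using not_less_Least that unfolding i_def by blast
  ultimately show ?thesis unfolding lexpos_def by (cases "g i > 0") (force intro!: exI[of _ i])+
qed

text \<open>The sum is positive at the smaller of the two first nonzero positions and zero before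
  it.\<close>

lemma lexpos_add: assumes "lexpos g" "lexpos h" shows "lexpos (g + h)"
proof -
  obtain i j where i: "g i > 0" "\<forall>j<i. g j = 0" and j: "h j > 0" "\<forall>i<j. h i = 0"
    using assms by (auto simp: lexpos_def)
  then show ?thesis unfolding lexpos_def
    by (cases i j rule: linorder_cases) (auto intro!: exI[of _ "min i j"])
qed

lemma lex_max:
  assumes "finite D" "D \<noteq> {}" shows "\<exists>g\<in>D. \<forall>h\<in>D. \<not> lexpos (h - g)"
  using assms
proof (induction D rule: finite_ne_induct)
  case (singleton x)
  then show ?case by (simp add: lexpos_def)
next
  case (insert x F)
  then obtain g where g: "g \<in> F" "\<forall>h\<in>F. \<not> lexpos (h - g)" by blast
  show ?case
  proof (cases "lexpos (x - g)")
    case True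
    have "\<not> lexpos (h - x)" if "h \<in> F" for h
      using lexpos_add[OF _ True, of "h - x"] g that by auto
    then show ?thesis by (auto simp: lexpos_def)
  next
    case False
    then show ?thesis using g by (intro bexI[of _ g]) (simp_all del: minus_apply)
  qed
qed

text \<open>Modulo \<open>I\<close>, the element has no component above degree zero and
  \<open>a P w\<close> in degree zero; lower components are arbitrary. That \<open>a P w\<close> is
  nonzero is recorded separately.\<close>

definition leads :: "('m kpgen list \<Rightarrow> 'r) \<Rightarrow> 'r \<Rightarrow> 'm \<Rightarrow> bool" where
  "leads x a w \<longleftrightarrow> x \<in> C \<and> (\<forall>h. lexpos h \<longrightarrow> comp h x \<in> I) \<and> comp 0 x \<approx> fa_smul a (P w)"

text \<open>Compressing the leading component, of degree \<open>g\<close>, by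
  \<open>homog_compress\<close> multiplies by elements of total degree \<open>- g\<close>; all
  components are shifted and the leading one lands in degree zero.\<close>

lemma leads_compress:
  assumes "x \<in> C" "x \<notin> I"
  obtains l m a where "l \<in> M" "m \<in> M" "s l = s m" "leads (T l \<cdot> x \<cdot> S m) a (s m)" "fa_smul a (P (s m)) \<notin> I"
proof -
  \<comment> \<open>The leading degree is taken among the components that are nonzero in the
    quotient, not merely in the free algebra.\<close>
  let ?D = "{g \<in> degs x. comp g x \<notin> I}"
  have "?D \<noteq> {}"
  proof
    assume "?D = {}"
    then have "(\<Sum>g\<in>degs x. comp g x) \<in> I" by (intro I_sum) blast
    then show False using sum_comp[OF assms(1)] assms(2) by simp
  qed
  then obtain g where g: "g \<in> ?D" "\<forall>h\<in>?D. \<not> lexpos (h - g)"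
    using lex_max[of ?D] finite_degs[OF assms(1)] by auto
  have top: "comp h x \<in> I" if "lexpos (h - g)" for h
  proof (cases "h \<in> degs x")
    case True then show ?thesis using g that by blast
  next
    case False
    then show ?thesis by (simp add: comp_outside_degs)
  qed
  obtain l m a where lm: "l \<in> M" "m \<in> M" "s l = s m" "dz l = dz m + g"
    "T l \<cdot> comp g x \<cdot> S m \<approx> fa_smul a (P (s m))" "fa_smul a (P (s m)) \<notin> I"
    using homog_compress[of "comp g x" g] g assms homog_comp by auto
  have e: "comp h (T l \<cdot> x \<cdot> S m) = T l \<cdot> comp (h + g) x \<cdot> S m" for h
  proof -
    have "comp h (T l \<cdot> x \<cdot> S m) = T l \<cdot> comp (h - dz m - (- dz l)) x \<cdot> S m"
      by (simp only: comp_mul_homog_left[OF homog_T] comp_mul_homog_right[OF homog_S])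
    also have "h - dz m - (- dz l) = h + g" using lm(4) by simp
    finally show ?thesis .
  qed
  have "leads (T l \<cdot> x \<cdot> S m) a (s m)"
    unfolding leads_def e using lm assms top by (auto simp: I_mul_left I_mul_right)
  then show thesis using that lm by blast
qed

text \<open>\<open>T l\<close> and \<open>S l\<close> have opposite degrees, so components keep
  their degree, while the vertex moves from \<open>r l\<close> to \<open>s l\<close>.\<close>

lemma leads_conj:
  assumes x: "leads x a w" and l: "l \<in> M" "r l = w"
  shows "leads (T l \<cdot> x \<cdot> S l) a (s l)"
proof -
  have e: "comp h (T l \<cdot> x \<cdot> S l) = T l \<cdot> comp h x \<cdot> S l" for h
  proof -
    have "comp h (T l \<cdot> x \<cdot> S l) = T l \<cdot> comp (h - dz l - (- dz l)) x \<cdot> S l"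
      by (simp only: comp_mul_homog_left[OF homog_T] comp_mul_homog_right[OF homog_S])
    then show ?thesis by simp
  qed
  have "T l \<cdot> comp 0 x \<cdot> S l \<approx> T l \<cdot> fa_smul a (P w) \<cdot> S l"
    using x l by (intro cong_mul_left cong_mul_right) (auto simp: leads_def)
  also have "\<dots> = fa_smul a (T l \<cdot> P (r l) \<cdot> S l)" by (simp add: fa_mul_smul_left fa_mul_smul_right l)
  also have "\<dots> \<approx> fa_smul a (T l \<cdot> S l)" using l by (intro cong_smul cong_mul_left TP) auto
  also have "\<dots> \<approx> fa_smul a (P (s l))" using TS_same_degree[of l l] l by (intro cong_smul) simp
  finally show ?thesis unfolding leads_def e using x l by (auto simp: leads_def I_mul_left I_mul_right)
qed

text \<open>The degree-zero part of the product collects the components of \<open>x\<close> and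
  \<open>y\<close> in degrees \<open>g\<close> and \<open>- g\<close>. For nonzero \<open>g\<close>
  one of these is lexicographically positive, so that term lies in \<open>I\<close> and only the
  product of the leading terms remains.\<close>

lemma leads_mul:
  assumes x: "leads x a w" and y: "leads y b w" and w: "w \<in> V" and xy: "x \<cdot> y \<in> I"
  shows "fa_smul (a * b) (P w) \<in> I"
proof -
  have C: "x \<in> C" "y \<in> C" using x y by (auto simp: leads_def)
  have "comp 0 (x \<cdot> y) = (\<Sum>g\<in>degs x. comp g x \<cdot> comp (- g) y)" using comp_mul[OF C(1), of 0 y] by simp
  \<comment> \<open>Degree zero is added to the index set in case it does not occur in
    \<open>x\<close>; its term can then be split off.\<close>
  also have "\<dots> = (\<Sum>g\<in>insert 0 (degs x). comp g x \<cdot> comp (- g) y)"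
  proof (rule sum.mono_neutral_left)
    show "\<forall>g\<in>insert 0 (degs x) - degs x. comp g x \<cdot> comp (- g) y = 0"
    proof
      fix g assume "g \<in> insert 0 (degs x) - degs x"
      then have "comp g x = 0" by (simp add: comp_outside_degs)
      then show "comp g x \<cdot> comp (- g) y = 0" by simp
    qed
  qed (use finite_degs[OF C(1)] in auto)
  also have "\<dots> = comp 0 x \<cdot> comp 0 y + (\<Sum>g\<in>degs x - {0}. comp g x \<cdot> comp (- g) y)"
    using finite_degs[OF C(1)] by (simp add: sum.insert_remove)
  finally have e: "comp 0 (x \<cdot> y) = \<dots>" .
  have "comp g x \<cdot> comp (- g) y \<in> I" if "g \<in> degs x - {0}" for g
    using lexpos_total[of g] that x y C by (auto simp: leads_def intro: I_mul_left I_mul_right)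
  then have "(\<Sum>g\<in>degs x - {0}. comp g x \<cdot> comp (- g) y) \<in> I" by (rule I_sum)
  with comp_I[OF xy, of 0] e have "comp 0 x \<cdot> comp 0 y \<in> I" using I_diff by fastforce
  moreover have "comp 0 x \<cdot> comp 0 y \<approx> fa_smul a (P w) \<cdot> fa_smul b (P w)"
    using x y by (intro cong_mul) (auto simp: leads_def)
  moreover have "fa_smul a (P w) \<cdot> fa_smul b (P w) = fa_smul (a * b) (P w \<cdot> P w)"
    by (simp add: fa_mul_smul_left fa_mul_smul_right fa_smul_smul mult.commute)
  moreover have "\<dots> \<approx> fa_smul (a * b) (P w)" using PP[OF w w] by (intro cong_smul) simp
  ultimately show ?thesis using cong_in_I_iff by metis
qed

end

section \<open>The representation on germs\<close>

locale kp_convex = kp k M V r s c d R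
  for k :: nat and M V :: "'m set" and r s :: "'m \<Rightarrow> 'm"
    and c :: "'m \<Rightarrow> 'm \<Rightarrow> 'm" and d :: "'m \<Rightarrow> nat \<Rightarrow> nat" and R :: "'r::comm_ring_1 itself" +
  assumes convex: "locally_convex k M V r s d"
begin

definition has_edge :: "'m \<Rightarrow> nat \<Rightarrow> bool" where
  "has_edge v i \<longleftrightarrow> (\<exists>a\<in>M. r a = v \<and> d a = ev i)"

lemma has_edge_less: "has_edge v i \<Longrightarrow> i < k"
  unfolding has_edge_def using ev_less by (metis ev_def zero_less_one)

lemma has_edge_convex:
  assumes "l \<in> M" "d l = ev j" "i \<noteq> j" "has_edge (r l) i" shows "has_edge (s l) i"
proof -
  obtain a where a: "a \<in> M" "r a = r l" "d a = ev i" using assms(4) by (auto simp: has_edge_def)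
  have "i < k" using has_edge_less[OF assms(4)] .
  moreover have "j < k" using ev_less[of l j] assms(1,2) by (simp add: ev_def)
  moreover have "r l \<in> V" using assms(1) by simp
  ultimately have "\<exists>b\<in>M. r b = s l \<and> d b = ev i"
    using convex[unfolded locally_convex_def] assms a by (metis)
  then show ?thesis by (simp add: has_edge_def)
qed

text \<open>Local convexity applied edge by edge along \<open>l\<close>, by induction on the total
  degree: a path without edges in direction \<open>i\<close> cannot lose the possibility of leaving
  in that direction.\<close>

lemma has_edge_persists:
  assumes "l \<in> M" "d l i = 0" "has_edge (r l) i" shows "has_edge (s l) i"
  using assms
proof (induction "\<Sum>j<k. d l j" arbitrary: l rule: less_induct)
  case less
  show ?case
  proof (cases "d l = 0")
    case True
    then have "l \<in> V" using less d_zero_vertex by blast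
    then show ?thesis using less.prems(3) by simp
  next
    case False
    then obtain j where j: "d l j > 0" by (auto simp: fun_eq_iff)
    then have jk: "j < k" using ev_less less by blast
    have "ev j \<le> d l" using j by (auto simp: le_fun_def ev_def)
    then obtain a b where ab: "a \<in> M" "b \<in> M" "s a = r b" "c a b = l" "d a = ev j" "d b = d l - ev j"
      using factor less.prems(1) by metis
    have ij: "i \<noteq> j" using j less.prems(2) by auto
    have "r a = r l" using ab by (metis r_comp)
    then have "has_edge (r b) i" using has_edge_convex[OF ab(1,5) ij] ab(3) less.prems(3) by simp
    moreover have "d b i = 0" using ab(6) less.prems(2) by simp
    moreover have "(\<Sum>j<k. d b j) < (\<Sum>j<k. d l j)"
      by (rule sum_strict_mono_ex1) (use ab j jk in \<open>auto simp: ev_def intro!: bexI[of _ j]\<close>)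
    ultimately have "has_edge (s b) i" using less.hyps ab(2) by blast
    moreover have "s b = s l" using ab by (metis s_comp)
    ultimately show ?thesis by simp
  qed
qed

text \<open>The sets \<open>deep n\<close> are the neighbourhoods of infinity in \<open>\<Lambda>\<close>; germs there of functions on
  \<open>\<Lambda>\<close> replace functions on the boundary path space.\<close>
definition deep :: "(nat \<Rightarrow> nat) \<Rightarrow> 'm set" where
  "deep n = {l \<in> M. \<forall>i. d l i \<ge> n i \<or> \<not> has_edge (s l) i}"

lemma deep_comp: "l \<in> M \<Longrightarrow> x \<in> deep n \<Longrightarrow> s l = r x \<Longrightarrow> c l x \<in> deep n"
  by (auto simp: deep_def) (metis trans_le_add2)

lemma deep_tail:
  assumes "l \<in> M" "x \<in> M" "s l = r x" "c l x \<in> deep (n + d l)" shows "x \<in> deep n"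
  using assms by (fastforce simp: deep_def)

lemma deep_mono: "n \<le> m \<Longrightarrow> deep m \<subseteq> deep n"
  unfolding deep_def le_fun_def by (auto intro: order_trans)

text \<open>Row-finiteness makes the paths from \<open>v\<close> of degree at most \<open>n\<close>
  finite in number. One of maximal total degree is deep, since an available edge in an unfilled
  coordinate would lengthen it.\<close>

lemma deep_ex:
  assumes "v \<in> V" "n \<in> NK" obtains l where "l \<in> deep n" "r l = v"
proof -
  let ?A = "{l \<in> M. r l = v \<and> d l \<le> n}"
  have fin: "finite ?A" using finite_paths_le assms by blast
  have "v \<in> ?A" using assms V_sub by (auto simp: le_fun_def)
  then have ne: "(\<lambda>l. \<Sum>i<k. d l i) ` ?A \<noteq> {}" by blast
  obtain l where l: "l \<in> ?A" "(\<Sum>i<k. d l i) = Max ((\<lambda>l. \<Sum>i<k. d l i) ` ?A)"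
    using Max_in[OF finite_imageI[OF fin] ne] by (auto simp del: Max_in)
  have max: "(\<Sum>i<k. d m i) \<le> (\<Sum>i<k. d l i)" if "m \<in> ?A" for m
    unfolding l(2) by (rule Max_ge[OF finite_imageI[OF fin] imageI[OF that]])
  have "d l i \<ge> n i" if e: "has_edge (s l) i" for i
  proof (rule ccontr)
    assume "\<not> ?thesis"
    then have lt: "d l i < n i" by simp
    obtain a where a: "a \<in> M" "r a = s l" "d a = ev i" using e by (auto simp: has_edge_def)
    have "d l + ev i \<le> n" using lt l(1) by (auto simp: le_fun_def ev_def)
    then have "c l a \<in> ?A" using l(1) a by simp
    then have "(\<Sum>j<k. d (c l a) j) \<le> (\<Sum>j<k. d l j)" by (rule max)
    moreover have "(\<Sum>j<k. d (c l a) j) = (\<Sum>j<k. d l j) + (\<Sum>j<k. ev i j)"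
      using a l(1) by (simp add: sum.distrib)
    moreover have "(\<Sum>j<k. ev i j) = 1" using has_edge_less[OF e] by (simp add: ev_def)
    ultimately show False by simp
  qed
  then have "l \<in> deep n" using l(1) by (auto simp: deep_def)
  then show thesis using that l(1) by blast
qed

lemma deep_prefix:
  assumes "x \<in> deep n" obtains l y where "l \<in> LEv (r x) n" "y \<in> M" "s l = r y" "c l y = x"
proof -
  have x: "x \<in> M" using assms by (simp add: deep_def)
  define p where "p = (\<lambda>i. min (d x i) (n i))"
  have "p \<le> d x" by (simp add: p_def le_fun_def)
  then obtain l y where ly: "l \<in> M" "y \<in> M" "s l = r y" "c l y = x" "d l = p" "d y = d x - p"
    using factor[OF x] by metis
  have "\<not> has_edge (s l) i" if "d l + ev i \<le> n" for i
  proof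
    assume e: "has_edge (s l) i"
    have "p i < n i" using le_funD[OF that, of i] ly(5) by (simp add: ev_def)
    then have "d x i < n i" "d y i = 0" using ly(6) by (auto simp: p_def)
    then have "has_edge (s y) i" using has_edge_persists[OF ly(2)] e ly(3) by simp
    moreover have "s y = s x" using ly by (metis s_comp)
    moreover have "n i \<le> d x i \<or> \<not> has_edge (s x) i" using assms by (simp add: deep_def)
    ultimately show False using \<open>d x i < n i\<close> by simp
  qed
  moreover have "d l \<le> n" using ly(5) by (simp add: p_def le_fun_def)
  moreover have "r l = r x" using ly by (metis r_comp)
  ultimately have "l \<in> LEv (r x) n" using ly(1) by (auto simp: LEv_def LE_paths_def has_edge_def)
  then show thesis using that ly by blast
qed

section \<open>The action of the free algebra on functions of paths\<close>

definition prefix :: "'m \<Rightarrow> 'm \<Rightarrow> bool" where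
  "prefix l x \<longleftrightarrow> (\<exists>y\<in>M. s l = r y \<and> c l y = x)"

definition tail :: "'m \<Rightarrow> 'm \<Rightarrow> 'm" where
  "tail l x = (THE y. y \<in> M \<and> s l = r y \<and> c l y = x)"

lemma tail_comp: assumes "l \<in> M" "y \<in> M" "s l = r y" shows "tail l (c l y) = y"
  unfolding tail_def
proof (rule the_equality)
  fix z assume "z \<in> M \<and> s l = r z \<and> c l z = c l y"
  then show "z = y" using comp_left_cancel assms by blast
qed (use assms in simp)

lemma prefix_comp: "l \<in> M \<Longrightarrow> y \<in> M \<Longrightarrow> s l = r y \<Longrightarrow> prefix l (c l y)"
  by (auto simp: prefix_def)

text \<open>\<open>actS l\<close> pushes a function forward along \<open>x \<mapsto> c l x\<close>,
  extending by zero; \<open>actT l\<close> pulls back along the same map, and \<open>actP v\<close>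
  restricts to paths with range \<open>v\<close>.\<close>

definition actS :: "'m \<Rightarrow> ('m \<Rightarrow> 'r) \<Rightarrow> 'm \<Rightarrow> 'r" where
  "actS l f x = (if prefix l x then f (tail l x) else 0)"
definition actT :: "'m \<Rightarrow> ('m \<Rightarrow> 'r) \<Rightarrow> 'm \<Rightarrow> 'r" where
  "actT l f x = (if s l = r x then f (c l x) else 0)"
definition actP :: "'m \<Rightarrow> ('m \<Rightarrow> 'r) \<Rightarrow> 'm \<Rightarrow> 'r" where
  "actP v f x = (if r x = v then f x else 0)"

primrec actg :: "'m kpgen \<Rightarrow> ('m \<Rightarrow> 'r) \<Rightarrow> 'm \<Rightarrow> 'r" where
  "actg (Pg v) f = actP v f"
| "actg (Sg l) f = actS l f"
| "actg (Sstg l) f = actT l f"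

definition actw :: "'m kpgen list \<Rightarrow> ('m \<Rightarrow> 'r) \<Rightarrow> 'm \<Rightarrow> 'r" where
  "actw w f = foldr actg w f"

definition act :: "('m kpgen list \<Rightarrow> 'r) \<Rightarrow> ('m \<Rightarrow> 'r) \<Rightarrow> 'm \<Rightarrow> 'r" where
  "act F f x = (\<Sum>w | F w \<noteq> 0. F w * actw w f x)"

lemma actg_sum: "actg g (\<lambda>x. \<Sum>u\<in>U. b u * h u x) = (\<lambda>x. \<Sum>u\<in>U. b u * actg g (h u) x)"
  by (cases g) (auto simp: fun_eq_iff actS_def actT_def actP_def)

lemma actw_simps: "actw [] f = f" "actw (g # w) f = actg g (actw w f)" "actw (u @ w) f = actw u (actw w f)"
  by (simp_all add: actw_def)

lemma actw_sum: "actw w (\<lambda>x. \<Sum>u\<in>U. b u * h u x) = (\<lambda>x. \<Sum>u\<in>U. b u * actw w (h u) x)"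
  by (induction w) (simp_all add: actw_simps actg_sum)

lemma act_superset: "finite A \<Longrightarrow> {w. F w \<noteq> 0} \<subseteq> A \<Longrightarrow> act F f x = (\<Sum>w\<in>A. F w * actw w f x)"
  unfolding act_def by (rule sum.mono_neutral_left) auto

lemma act_mono_word: "act (mono_word w) f x = actw w f x"
  by (subst act_superset[of "{w}"]) (auto simp: mono_word_def)

lemma act_zero [simp]: "act 0 f x = 0"
  by (simp add: act_def)

lemma finite_supp: "F \<in> C \<Longrightarrow> finite {w. F w \<noteq> 0}"
  by (simp add: fa_carrier_def)

lemma act_add: assumes "F \<in> C" "H \<in> C" shows "act (F + H) f x = act F f x + act H f x"
proof -
  let ?A = "{w. F w \<noteq> 0} \<union> {w. H w \<noteq> 0}"
  have A: "finite ?A" using assms finite_supp by simp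
  have "act (F + H) f x = (\<Sum>w\<in>?A. (F + H) w * actw w f x)" by (rule act_superset[OF A]) auto
  also have "\<dots> = (\<Sum>w\<in>?A. F w * actw w f x) + (\<Sum>w\<in>?A. H w * actw w f x)"
    by (simp add: sum.distrib algebra_simps)
  also have "\<dots> = act F f x + act H f x" using A by (simp add: act_superset[OF A])
  finally show ?thesis .
qed

lemma act_smul: assumes "F \<in> C" shows "act (fa_smul a F) f x = a * act F f x"
  by (subst act_superset[OF finite_supp[OF assms]])
     (auto simp: fa_smul_def act_def sum_distrib_left mult.assoc)

lemma act_diff: assumes "F \<in> C" "H \<in> C" shows "act (F - H) f x = act F f x - act H f x"
  using act_add[of F "fa_smul (- 1) H" f x] act_smul[of H "- 1" f x] assms by simp

lemma act_sum: "(\<And>i. i \<in> A \<Longrightarrow> F i \<in> C) \<Longrightarrow> act (sum F A) f x = (\<Sum>i\<in>A. act (F i) f x)"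
proof (induction A rule: infinite_finite_induct)
  case (insert i A)
  then have "act (sum F (insert i A)) f x = act (F i) f x + act (sum F A) f x"
    using act_add[of "F i" "sum F A" f x] by (simp only: sum.insert fa_carrier_sum insert_iff simp_thms)
  also have "\<dots> = (\<Sum>i\<in>insert i A. act (F i) f x)" using insert by simp
  finally show ?case .
qed (simp_all only: sum.infinite sum.empty act_zero not_False_eq_True)

text \<open>Expand both factors in monomials: concatenation of words acts by composition, and
  linearity of \<open>actw\<close> moves the inner sum out.\<close>

lemma act_mul: assumes "F \<in> C" "H \<in> C" shows "act (F \<cdot> H) f x = act F (act H f) x"
proof -
  let ?A = "{w. F w \<noteq> 0}" and ?B = "{w. H w \<noteq> 0}"
  have fin: "finite ?A" "finite ?B" using assms finite_supp by auto
  have w: "mono_word w \<in> C" if "w \<in> ?A \<or> w \<in> ?B" for w :: "'m kpgen list"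
  proof (rule fa_carrier_mono_word)
    show "w \<noteq> []" "set w \<subseteq> gens" using that assms unfolding fa_carrier_def by blast+
  qed
  have "F = (\<Sum>u\<in>?A. fa_smul (F u) (mono_word u))" "H = (\<Sum>v\<in>?B. fa_smul (H v) (mono_word v))"
    using fin by (auto intro!: fa_eq_sum_mono_word)
  then have "F \<cdot> H = (\<Sum>u\<in>?A. fa_smul (F u) (mono_word u)) \<cdot> (\<Sum>v\<in>?B. fa_smul (H v) (mono_word v))" by simp
  also have "\<dots> = (\<Sum>u\<in>?A. \<Sum>v\<in>?B. fa_smul (F u) (fa_smul (H v) (mono_word (u @ v))))"
    by (simp add: fa_mul_sum_left) (simp add: fa_mul_sum_right fa_mul_smul_left fa_mul_smul_right mono_word_mul fa_smul_sum
        fa_smul_smul mult.commute)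
  finally have e: "F \<cdot> H = \<dots>" .
  have ws: "mono_word (u @ v) \<in> C" if "u \<in> ?A" "v \<in> ?B" for u v :: "'m kpgen list"
    using w[of u] w[of v] that by (simp flip: mono_word_mul)
  have "act (F \<cdot> H) f x = (\<Sum>u\<in>?A. \<Sum>v\<in>?B. F u * (H v * actw u (actw v f) x))"
  proof -
    have "act (\<Sum>v\<in>?B. fa_smul (F u) (fa_smul (H v) (mono_word (u @ v)))) f x
        = (\<Sum>v\<in>?B. F u * (H v * actw u (actw v f) x))" if "u \<in> ?A" for u
    proof (subst act_sum)
      show "(\<Sum>v\<in>?B. act (fa_smul (F u) (fa_smul (H v) (mono_word (u @ v)))) f x)
          = (\<Sum>v\<in>?B. F u * (H v * actw u (actw v f) x))"
        using ws[OF that] by (intro sum.cong) (simp_all add: act_smul act_mono_word actw_simps)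
    qed (use ws[OF that] in simp)
    moreover have "(\<Sum>v\<in>?B. fa_smul (F u) (fa_smul (H v) (mono_word (u @ v)))) \<in> C" if "u \<in> ?A" for u
      using ws[OF that] by (intro fa_carrier_sum fa_carrier_smul)
    ultimately show ?thesis unfolding e by (subst act_sum) simp_all
  qed
  also have "\<dots> = act F (act H f) x"
    unfolding act_def[of F] act_def[of H, abs_def] actw_sum by (simp add: sum_distrib_left)
  finally show ?thesis .
qed

lemma actS_comp: "l \<in> M \<Longrightarrow> y \<in> M \<Longrightarrow> s l = r y \<Longrightarrow> actS l f (c l y) = f y"
  by (simp add: actS_def prefix_comp tail_comp)

lemma actS_not_prefix: "\<not> prefix l x \<Longrightarrow> actS l f x = 0"
  by (simp add: actS_def)

lemma act_gen: "act (fa_gen g) f x = actg g f x"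
  by (simp add: fa_gen_eq_mono_word act_mono_word actw_simps)

lemma actS_vertex: assumes "v \<in> V" "x \<in> M" shows "actS v f x = actP v f x"
proof (cases "r x = v")
  case True
  then have "c v x = x" using assms by auto
  then show ?thesis using actS_comp[of v x f] assms V_sub True by (simp add: actP_def)
next
  case False
  then have "\<not> prefix v x" using assms V_sub by (auto simp: prefix_def)
  then show ?thesis using False by (simp add: actS_not_prefix actP_def)
qed

lemma actT_vertex: "v \<in> V \<Longrightarrow> x \<in> M \<Longrightarrow> actT v f x = actP v f x"
  by (auto simp: actT_def actP_def)

lemma act_P: "act (P v) f x = actP v f x"
  by (simp add: P_def kpP_def act_gen)

text \<open>Values are compared at paths only, as the functions live on the whole type. In degree
  zero \<open>S l\<close> is the generator \<open>Pg l\<close>, which needs the agreement of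
  \<open>actS\<close> with \<open>actP\<close> on vertices.\<close>

lemma act_S: assumes "l \<in> M" "x \<in> M" shows "act (S l) f x = actS l f x"
proof (cases "d l = 0")
  case True
  then have "l \<in> V" using d_zero_vertex assms(1) by blast
  then show ?thesis using actS_vertex assms(2) by (simp add: S_vertex act_P)
qed (simp add: S_def kpS_def act_gen)

lemma act_T: assumes "l \<in> M" "x \<in> M" shows "act (T l) f x = actT l f x"
proof (cases "d l = 0")
  case True
  then have "l \<in> V" using d_zero_vertex assms(1) by blast
  then show ?thesis using actT_vertex assms(2) by (simp add: T_vertex act_P)
qed (simp add: T_def kpSst_def act_gen)

lemma prefixE: assumes "prefix l x" obtains y where "y \<in> M" "s l = r y" "x = c l y"
  using assms by (auto simp: prefix_def)

lemma act_SS: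
  assumes "l \<in> M" "m \<in> M" "s l = r m" "x \<in> M"
  shows "act (S l \<cdot> S m) f x = act (S (c l m)) f x"
proof -
  have "act (S l \<cdot> S m) f x = actS l (act (S m) f) x" using assms by (simp add: act_mul act_S)
  also have "\<dots> = actS (c l m) f x"
  proof (cases "prefix l x")
    case True
    then obtain y where y: "y \<in> M" "s l = r y" "x = c l y" by (rule prefixE)
    show ?thesis
    proof (cases "prefix m y")
      case True
      then obtain z where z: "z \<in> M" "s m = r z" "y = c m z" by (rule prefixE)
      have "x = c (c l m) z" using y z assms by (simp add: comp_assoc)
      then have "actS (c l m) f x = f z" using assms z actS_comp[of "c l m" z f] by simp
      moreover have "actS l (act (S m) f) x = f z" using assms y z by (simp add: actS_comp act_S)
      ultimately show ?thesis by simp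
    next
      case False
      have "\<not> prefix (c l m) x"
      proof
        assume "prefix (c l m) x"
        then obtain z where z: "z \<in> M" "s (c l m) = r z" "x = c (c l m) z" by (rule prefixE)
        then have "c l y = c l (c m z)" using y assms by (simp add: comp_assoc)
        then have "y = c m z" using comp_left_cancel[of l y "c m z"] y z assms by simp
        then show False using False prefix_comp z assms by simp
      qed
      then show ?thesis using False y assms by (simp add: actS_comp act_S actS_not_prefix)
    qed
  next
    case False
    have "\<not> prefix (c l m) x"
    proof
      assume "prefix (c l m) x"
      then obtain z where z: "z \<in> M" "s (c l m) = r z" "x = c (c l m) z" by (rule prefixE)
      then have "x = c l (c m z)" using assms by (simp add: comp_assoc)
      then show False using False prefix_comp[of l "c m z"] z assms by simp
    qed
    then show ?thesis using False by (simp add: actS_not_prefix)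
  qed
  finally show ?thesis using assms by (simp add: act_S)
qed

lemma act_TT:
  assumes "l \<in> M" "m \<in> M" "s l = r m" "x \<in> M"
  shows "act (T m \<cdot> T l) f x = act (T (c l m)) f x"
  using assms by (auto simp: act_mul act_T actT_def comp_assoc)

text \<open>If \<open>m\<close> is a prefix of \<open>c l x\<close>, then \<open>l\<close> and
  \<open>m\<close> are two prefixes of one path in \<open>LE n\<close>, hence equal.\<close>

lemma act_TS:
  assumes "l \<in> LE n" "m \<in> LE n" "x \<in> M"
  shows "act (T l \<cdot> S m) f x = act (if l = m then P (s l) else 0) f x"
proof -
  have lm: "l \<in> M" "m \<in> M" using assms LE_M by auto
  have e: "act (T l \<cdot> S m) f x = (if s l = r x then actS m f (c l x) else 0)"
    using lm assms by (simp add: act_mul act_T actT_def act_S)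
  show ?thesis
  proof (cases "s l = r x")
    case sr: True
    show ?thesis
    proof (cases "prefix m (c l x)")
      case True
      then obtain y where y: "y \<in> M" "s m = r y" "c l x = c m y" by (rule prefixE)
      then have "l = m" "x = y" using LE_prefix_unique[OF assms(1,2) assms(3) y(1) sr y(2,3)] by auto
      then show ?thesis using e sr lm y by (simp add: actS_comp act_P actP_def)
    next
      case False
      then have "l \<noteq> m" using prefix_comp lm assms sr by blast
      then show ?thesis using e False by (simp add: actS_not_prefix)
    qed
  next
    case False
    then show ?thesis using e by (auto simp: act_P actP_def)
  qed
qed

text \<open>A deep path with range \<open>v\<close> has exactly one prefix in
  \<open>LEv v n\<close>, so one summand reproduces the value. A path that is not deep may have no
  such prefix, which is why functions are considered up to germs.\<close>

lemma act_CK: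
  assumes "v \<in> V" "n \<in> NK" "x \<in> deep n"
  shows "act (\<Sum>l\<in>LEv v n. S l \<cdot> T l) f x = act (P v) f x"
proof -
  have x: "x \<in> M" using assms by (simp add: deep_def)
  have t: "act (S l \<cdot> T l) f x = (if prefix l x then f x else 0)" if "l \<in> LEv v n" for l
  proof (cases "prefix l x")
    case True
    then obtain y where "y \<in> M" "s l = r y" "x = c l y" by (rule prefixE)
    then show ?thesis using True LEvD[OF that] x by (simp add: act_mul act_S actS_comp act_T actT_def)
  next
    case False
    then show ?thesis using LEvD[OF that] x by (simp add: act_mul act_S actS_not_prefix)
  qed
  have "act (\<Sum>l\<in>LEv v n. S l \<cdot> T l) f x = (\<Sum>l\<in>LEv v n. if prefix l x then f x else 0)"
    using t by (subst act_sum) (auto simp: LEvD intro!: sum.cong)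
  also have "\<dots> = actP v f x"
  proof (cases "r x = v")
    case True
    obtain l y where l: "l \<in> LEv v n" "y \<in> M" "s l = r y" "c l y = x"
      using deep_prefix[OF assms(3)] True by metis
    have "prefix m x \<longleftrightarrow> m = l" if "m \<in> LEv v n" for m
    proof
      assume "prefix m x"
      then obtain z where "z \<in> M" "s m = r z" "x = c m z" by (rule prefixE)
      then show "m = l" using LE_prefix_unique[of m n l z y] LEvD[OF that] LEvD[OF l(1)] l by simp
    next
      assume "m = l"
      then show "prefix m x" using prefix_comp l LEvD by blast
    qed
    then have "(\<Sum>l\<in>LEv v n. if prefix l x then f x else 0) = (\<Sum>m\<in>LEv v n. if m = l then f x else 0)"
      by (intro sum.cong) auto
    then show ?thesis using finite_LEv[OF assms(2,1)] l(1) True by (simp add: actP_def)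
  next
    case False
    have "\<not> prefix l x" if "l \<in> LEv v n" for l
      using False LEvD[OF that] by (auto elim!: prefixE)
    then show ?thesis using False by (simp add: actP_def)
  qed
  finally show ?thesis by (simp add: act_P)
qed

section \<open>Germs at infinity and independence of the vertex idempotents over
  \<open>R\<close>\<close>

definition null_germ :: "('m \<Rightarrow> 'r) \<Rightarrow> bool" where
  "null_germ f \<longleftrightarrow> (\<exists>n\<in>NK. \<forall>x\<in>deep n. f x = 0)"

lemma null_germI_all: "(\<And>x. x \<in> M \<Longrightarrow> f x = 0) \<Longrightarrow> null_germ f"
  unfolding null_germ_def by (auto simp: deep_def NK_def intro!: bexI[of _ 0])

lemma NK_add: "n \<in> NK \<Longrightarrow> m \<in> NK \<Longrightarrow> n + m \<in> NK" by (simp add: NK_def)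

lemma null_germ_add: assumes "null_germ f" "null_germ h" shows "null_germ (\<lambda>x. f x + h x)"
proof -
  obtain n m where n: "n \<in> NK" "\<forall>x\<in>deep n. f x = 0" and m: "m \<in> NK" "\<forall>x\<in>deep m. h x = 0"
    using assms by (auto simp: null_germ_def)
  have "deep (n + m) \<subseteq> deep n" "deep (n + m) \<subseteq> deep m" by (auto intro!: deep_mono simp: le_fun_def)
  then have "f x + h x = 0" if "x \<in> deep (n + m)" for x using n m that by (simp add: subset_iff)
  then show ?thesis unfolding null_germ_def using NK_add n m by blast
qed

lemma null_germ_smul: "null_germ f \<Longrightarrow> null_germ (\<lambda>x. a * f x)"
  unfolding null_germ_def by (metis mult_zero_right)

lemma null_germ_sum: "(\<And>i. i \<in> A \<Longrightarrow> null_germ (f i)) \<Longrightarrow> null_germ (\<lambda>x. \<Sum>i\<in>A. f i x)"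
  by (induction A rule: infinite_finite_induct) (auto intro: null_germ_add null_germI_all)

text \<open>Removing a prefix \<open>l\<close> lowers the degree by \<open>d l\<close>, so
  \<open>Sg l\<close> raises the threshold by that amount; \<open>Pg v\<close> and
  \<open>Sstg l\<close> keep the threshold.\<close>

lemma null_germ_actg:
  assumes "null_germ f" "g \<in> gens" shows "null_germ (actg g f)"
proof -
  obtain n where n: "n \<in> NK" "\<forall>x\<in>deep n. f x = 0" using assms by (auto simp: null_germ_def)
  show ?thesis
  proof (cases g)
    case (Pg v)
    then show ?thesis using n unfolding null_germ_def by (auto simp: actP_def)
  next
    case (Sg l)
    then have l: "l \<in> M" using assms by (auto simp: kp_gens_def)
    have "actS l f x = 0" if x: "x \<in> deep (n + d l)" for x
    proof (cases "prefix l x")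
      case True
      then obtain y where y: "y \<in> M" "s l = r y" "x = c l y" by (rule prefixE)
      then show ?thesis using deep_tail[OF l] x n(2) l by (simp add: actS_comp)
    qed (simp add: actS_not_prefix)
    then show ?thesis unfolding null_germ_def using Sg n l NK_add d_NK by (intro bexI[of _ "n + d l"]) auto
  next
    case (Sstg l)
    then have l: "l \<in> M" using assms by (auto simp: kp_gens_def)
    then show ?thesis using Sstg n deep_comp[OF l] unfolding null_germ_def by (auto simp: actT_def)
  qed
qed

lemma null_germ_actw: "null_germ f \<Longrightarrow> set w \<subseteq> gens \<Longrightarrow> null_germ (actw w f)"
  by (induction w) (simp_all add: actw_simps null_germ_actg)

lemma null_germ_act: assumes "null_germ f" "F \<in> C" shows "null_germ (act F f)"
proof -
  have "null_germ (\<lambda>x. \<Sum>w\<in>{w. F w \<noteq> 0}. F w * actw w f x)"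
    using assms by (intro null_germ_sum null_germ_smul null_germ_actw) (auto simp: fa_carrier_def)
  then show ?thesis by (simp add: act_def[abs_def])
qed

text \<open>All relations hold at every path except the Cuntz--Krieger relation for
  \<open>n\<close>, which is established on \<open>deep n\<close>.\<close>

lemma act_rel_null:
  assumes "F \<in> Rels" shows "null_germ (act F f)"
  using assms
proof (cases rule: kp_rels_cases)
  case (PP v w)
  then show ?thesis by (intro null_germI_all) (auto simp: act_diff act_mul act_P actP_def)
next
  case (SS l m)
  then show ?thesis by (intro null_germI_all) (simp add: act_diff act_SS)
next
  case (TT l m)
  then show ?thesis by (intro null_germI_all) (simp add: act_diff act_TT)
next
  case (PS l)
  then show ?thesis using act_SS[of "r l" l] V_sub[of "r l"]
    by (intro null_germI_all) (simp add: act_diff S_vertex)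
next
  case (SP l)
  then show ?thesis using act_SS[of l "s l"] V_sub[of "s l"]
    by (intro null_germI_all) (simp add: act_diff S_vertex)
next
  case (PT l)
  then show ?thesis using act_TT[of l "s l"] V_sub[of "s l"]
    by (intro null_germI_all) (simp add: act_diff T_vertex)
next
  case (TP l)
  then show ?thesis using act_TT[of "r l" l] V_sub[of "r l"]
    by (intro null_germI_all) (simp add: act_diff T_vertex)
next
  case (TS l m n)
  have "T l \<cdot> S m \<in> C" "(if l = m then P (s l) else 0) \<in> C" using TS LE_M by auto
  then show ?thesis unfolding TS(5)
    by (intro null_germI_all) (simp only: act_diff act_TS[OF TS(3,4)] diff_self)
next
  case (CK v n)
  have "P v \<in> C" "(\<Sum>l\<in>LEv v n. S l \<cdot> T l) \<in> C" using CK LEvD by (auto intro!: fa_carrier_sum)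
  then have "act F f x = 0" if "x \<in> deep n" for x
    unfolding CK(4) using act_CK[OF CK(1,2) that] by (simp add: act_diff)
  then show ?thesis unfolding null_germ_def using CK(2) by blast
qed

text \<open>The elements that send every function to a null germ form an ideal: right multiplication
  changes only the function, and left multiplication preserves null germs.\<close>

lemma act_I_null: assumes "F \<in> I" shows "null_germ (act F f)"
proof -
  let ?J = "{F \<in> C. \<forall>f. null_germ (act F f)}"
  have "fa_ideal gens ?J"
    unfolding fa_ideal_def
  proof (intro conjI ballI allI)
    fix F H assume "F \<in> ?J" "H \<in> ?J"
    moreover from this have "act (F + H) f = (\<lambda>x. act F f x + act H f x)" for f by (auto simp: act_add)
    ultimately show "F + H \<in> ?J" using null_germ_add by auto
  next
    fix F H assume "F \<in> ?J" "H \<in> C"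
    moreover from this have "act (F \<cdot> H) f = act F (act H f)" "act (H \<cdot> F) f = act H (act F f)" for f
      by (auto simp: act_mul)
    ultimately show "F \<cdot> H \<in> ?J" "H \<cdot> F \<in> ?J" using null_germ_act by auto
  next
    fix a F assume "F \<in> ?J"
    moreover from this have "act (fa_smul a F) f = (\<lambda>x. a * act F f x)" for f by (auto simp: act_smul)
    ultimately show "fa_smul a F \<in> ?J" using null_germ_smul by auto
  qed (auto intro: null_germI_all)
  moreover have "Rels \<subseteq> ?J" using act_rel_null rels_carrier by auto
  ultimately show ?thesis using I_least assms by blast
qed

text \<open>Applied to the constant function \<open>1\<close>, the element \<open>a P v\<close>
  takes the value \<open>a\<close> at every path with range \<open>v\<close>, and such paths occur
  in each \<open>deep n\<close>.\<close>

lemma smul_P_in_I_iff: assumes "v \<in> V" shows "fa_smul a (P v) \<in> I \<longleftrightarrow> a = 0"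
proof
  assume "fa_smul a (P v) \<in> I"
  then have "null_germ (act (fa_smul a (P v)) (\<lambda>_. 1))" by (rule act_I_null)
  then obtain n where n: "n \<in> NK" "\<forall>x\<in>deep n. act (fa_smul a (P v)) (\<lambda>_. 1) x = 0"
    by (auto simp: null_germ_def)
  obtain x where "x \<in> deep n" "r x = v" using deep_ex assms n(1) by blast
  then have "act (fa_smul a (P v)) (\<lambda>_. 1) x = 0" using n(2) by blast
  then show "a = 0" using assms \<open>r x = v\<close> by (simp add: act_smul act_P actP_def)
qed simp

lemma P_notin_I: "v \<in> V \<Longrightarrow> (1::'r) \<noteq> 0 \<Longrightarrow> P v \<notin> I"
  using smul_P_in_I_iff[of v 1] by simp

section \<open>Primeness\<close>

text \<open>A spanning product \<open>S l \<cdot> T m\<close> survives between \<open>P v1\<close>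
  and \<open>P v2\<close> only if \<open>r l = v1\<close> and \<open>r m = v2\<close>; its legs
  share their source, which \<open>sep\<close> forbids.\<close>

lemma corner_zero:
  assumes v: "v1 \<in> V" "v2 \<in> V"
    and sep: "\<And>l m. l \<in> M \<Longrightarrow> m \<in> M \<Longrightarrow> r l = v1 \<Longrightarrow> r m = v2 \<Longrightarrow> s l \<noteq> s m"
    and x: "x \<in> C"
  shows "P v1 \<cdot> x \<cdot> P v2 \<in> I"
proof -
  let ?X = "\<Union>g. spanning_pairs g"
  have "(\<Sum>g\<in>degs x. comp g x) \<in> span ?X"
  proof (rule span_sum)
    fix g
    have "comp g x \<in> span (spanning_pairs g)" using homog_span homog_comp x by simp
    then show "comp g x \<in> span ?X" using span_mono[of "spanning_pairs g" ?X] by blast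
  qed
  then have "x \<in> span ?X" using sum_comp[OF x] by simp
  then obtain A a where A: "A \<subseteq> ?X" "x \<approx> (\<Sum>t\<in>A. fa_smul (a t) (ST t))" by (auto simp: span_def)
  have "P v1 \<cdot> x \<cdot> P v2 \<approx> P v1 \<cdot> (\<Sum>t\<in>A. fa_smul (a t) (ST t)) \<cdot> P v2"
    using A v by (intro cong_mul_left cong_mul_right) auto
  also have "\<dots> = (\<Sum>t\<in>A. fa_smul (a t) ((P v1 \<cdot> S (fst t)) \<cdot> (T (snd t) \<cdot> P v2)))"
    by (simp add: fa_mul_sum_left fa_mul_sum_right fa_mul_smul_left fa_mul_smul_right fa_mul_assoc)
  finally have e: "P v1 \<cdot> x \<cdot> P v2 \<approx> \<dots>" .
  have "fa_smul (a t) ((P v1 \<cdot> S (fst t)) \<cdot> (T (snd t) \<cdot> P v2)) \<in> I" if t: "t \<in> A" for t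
  proof -
    have lm: "fst t \<in> M" "snd t \<in> M" "s (fst t) = s (snd t)"
      using t A(1) by (auto simp: spanning_pairs_def)
    consider "r (fst t) \<noteq> v1" | "r (snd t) \<noteq> v2" using sep lm by blast
    then show ?thesis
    proof cases
      case 1
      then have "P v1 \<cdot> S (fst t) \<in> I"
        using SS_zero[of v1 "fst t"] v V_sub lm by (auto simp: S_vertex cong_zero_iff)
      then show ?thesis using lm v by (simp add: I_smul I_mul_right)
    next
      case 2
      then have "T (snd t) \<cdot> P v2 \<in> I"
        using TS_zero[of "snd t" v2] v V_sub lm by (auto simp: S_vertex cong_zero_iff)
      then show ?thesis using lm v by (simp add: I_smul I_mul_left)
    qed
  qed
  then have "(\<Sum>t\<in>A. fa_smul (a t) ((P v1 \<cdot> S (fst t)) \<cdot> (T (snd t) \<cdot> P v2))) \<in> I" by (rule I_sum)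
  then show ?thesis using cong_in_I_iff[OF e] by simp
qed

text \<open>The preimage in the free algebra of the ideal \<open>a KP\<close>.\<close>

lemma ring_ideal_scaled: "ring_ideal {x \<in> C. \<exists>y\<in>C. x \<approx> fa_smul a y}"
  unfolding rng_ideal_def
proof (intro conjI ballI)
  let ?A = "{x \<in> C. \<exists>y\<in>C. x \<approx> fa_smul a y}"
  show "0 \<in> ?A" by (auto intro!: bexI[of _ 0])
  fix x assume "x \<in> ?A"
  then obtain y where y: "x \<in> C" "y \<in> C" "x \<approx> fa_smul a y" by auto
  show "- x \<in> ?A" using y cong_uminus[OF y(3)] fa_smul_diff[of a 0 y] by (auto intro!: bexI[of _ "- y"])
  fix z assume z: "z \<in> C"
  show "fa_mul z x \<in> ?A"
    using y z cong_mul_right[OF y(3) z] by (auto simp: fa_mul_smul_right intro!: bexI[of _ "z \<cdot> y"])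
  show "fa_mul x z \<in> ?A"
    using y z cong_mul_left[OF y(3) z] by (auto simp: fa_mul_smul_left intro!: bexI[of _ "y \<cdot> z"])
next
  fix x x' assume "x \<in> {x \<in> C. \<exists>y\<in>C. x \<approx> fa_smul a y}" "x' \<in> {x \<in> C. \<exists>y\<in>C. x \<approx> fa_smul a y}"
  then obtain y y' where y: "x \<in> C" "y \<in> C" "x \<approx> fa_smul a y" "x' \<in> C" "y' \<in> C" "x' \<approx> fa_smul a y'" by auto
  then show "x + x' \<in> {x \<in> C. \<exists>y\<in>C. x \<approx> fa_smul a y}"
    using cong_add[OF y(3,6)] by (auto simp: fa_smul_add intro!: bexI[of _ "y + y'"])
qed blast

text \<open>For \<open>a * b = 0\<close> the ideals \<open>a KP\<close> and \<open>b KP\<close>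
  annihilate each other. One of them vanishes, and it contains \<open>a P v\<close> or
  \<open>b P v\<close>, which detects the scalar.\<close>

lemma prime_imp_domain:
  assumes "q_prime" "V \<noteq> {}" shows "integral_domain_ring TYPE('r)"
proof -
  obtain v where v: "v \<in> V" using assms by blast
  have "(1::'r) \<noteq> 0"
  proof
    assume "(1::'r) = 0"
    then have "(a::'r) = 0" for a by (metis mult_1 mult_zero_left)
    then have "f = 0" for f :: "'m kpgen list \<Rightarrow> 'r" by (auto simp: fun_eq_iff)
    then have "C \<subseteq> I" by (metis I_zero subsetI)
    then show False using q_prime_carrier[OF assms(1)] by blast
  qed
  moreover have "a = 0 \<or> b = 0" if ab: "a * b = 0" for a b :: 'r
  proof -
    let ?A = "\<lambda>a. {x \<in> C. \<exists>y\<in>C. x \<approx> fa_smul a y}"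
    have "fa_mul x x' \<in> I" if "x \<in> ?A a" "x' \<in> ?A b" for x x'
    proof -
      obtain y y' where y: "y \<in> C" "x \<approx> fa_smul a y" "y' \<in> C" "x' \<approx> fa_smul b y'" using \<open>x \<in> ?A a\<close> \<open>x' \<in> ?A b\<close> by auto
      have "fa_mul x x' \<approx> fa_mul (fa_smul a y) (fa_smul b y')" using y by (intro cong_mul)
      also have "\<dots> = fa_smul (a * b) (fa_mul y y')"
        by (simp add: fa_mul_smul_left fa_mul_smul_right fa_smul_smul mult.commute)
      finally show ?thesis using ab by (simp add: cong_zero_iff)
    qed
    then have "?A a \<subseteq> I \<or> ?A b \<subseteq> I"
      using q_primeD[OF assms(1) ring_ideal_scaled ring_ideal_scaled] by blast
    moreover have "fa_smul a (P v) \<in> ?A a" for a using v by (auto intro!: bexI[of _ "P v"])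
    ultimately show ?thesis using smul_P_in_I_iff[OF v] by blast
  qed
  ultimately show ?thesis by (simp add: integral_domain_ring_def)
qed

text \<open>Two vertices violating MT3 span a vanishing corner by \<open>corner_zero\<close>, and
  this separates two nonzero ideals with zero product.\<close>

lemma prime_imp_MT3:
  assumes prime: "q_prime" and one: "(1::'r) \<noteq> 0" shows "MT3 M V r s"
proof (rule ccontr)
  assume "\<not> ?thesis"
  then obtain v1 v2 where v: "v1 \<in> V" "v2 \<in> V"
    and nw: "\<And>w. w \<in> V \<Longrightarrow> \<not> ((\<exists>l\<in>M. r l = v1 \<and> s l = w) \<and> (\<exists>m\<in>M. r m = v2 \<and> s m = w))"
    unfolding MT3_def by blast
  have sep: "s l \<noteq> s m" if "l \<in> M" "m \<in> M" "r l = v1" "r m = v2" for l m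
    using nw[of "s l"] that s_V by metis
  \<comment> \<open>Annihilators avoid describing the ideals generated by the two vertex idempotents.\<close>
  define B where "B = {b \<in> C. \<forall>x\<in>C. P v1 \<cdot> x \<cdot> b \<in> I}"
  define A where "A = {a \<in> C. \<forall>b\<in>B. a \<cdot> b \<in> I}"
  have B: "ring_ideal B"
    unfolding rng_ideal_def
  proof (intro conjI ballI)
    fix b y assume b: "b \<in> B" and y: "y \<in> C"
    have "P v1 \<cdot> x \<cdot> (y \<cdot> b) \<in> I" if "x \<in> C" for x
    proof -
      have "P v1 \<cdot> (x \<cdot> y) \<cdot> b \<in> I" using b y that by (simp add: B_def)
      then show ?thesis by (simp add: fa_mul_assoc)
    qed
    then show "fa_mul y b \<in> B" using b y by (simp add: B_def)
    have "P v1 \<cdot> x \<cdot> (b \<cdot> y) \<in> I" if "x \<in> C" for x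
    proof -
      have "P v1 \<cdot> x \<cdot> b \<cdot> y \<in> I" using b y that by (intro I_mul_right[of "P v1 \<cdot> x \<cdot> b"]) (simp_all add: B_def)
      then show ?thesis by (simp add: fa_mul_assoc)
    qed
    then show "fa_mul b y \<in> B" using b y by (simp add: B_def)
  qed (auto simp: B_def fa_mul_add_right fa_mul_uminus_right I_add I_uminus)
  have A: "ring_ideal A"
    unfolding rng_ideal_def
  proof (intro conjI ballI)
    fix a y assume a: "a \<in> A" and y: "y \<in> C"
    have "y \<cdot> a \<cdot> b \<in> I" if "b \<in> B" for b
      using a y that by (simp add: A_def fa_mul_assoc I_mul_left)
    then show "fa_mul y a \<in> A" using a y by (simp add: A_def)
    have "a \<cdot> y \<cdot> b \<in> I" if "b \<in> B" for b
    proof -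
      have "y \<cdot> b \<in> B" using B y that by (simp add: rng_ideal_def)
      then show ?thesis using a by (simp add: A_def fa_mul_assoc)
    qed
    then show "fa_mul a y \<in> A" using a y by (simp add: A_def)
  qed (auto simp: A_def fa_mul_add_left fa_mul_uminus_left I_add I_uminus)
  have "P v1 \<in> A"
  proof -
    have "P v1 \<cdot> b \<in> I" if b: "b \<in> B" for b
    proof -
      \<comment> \<open>The algebra may have no unit, so \<open>P v1\<close> itself serves as the
        middle factor in the definition of \<open>B\<close>.\<close>
      have "P v1 \<cdot> P v1 \<cdot> b \<approx> P v1 \<cdot> b"
        using PP[OF v(1) v(1)] b by (intro cong_mul_left) (auto simp: B_def)
      moreover have "P v1 \<cdot> P v1 \<cdot> b \<in> I" using b v by (simp add: B_def)
      ultimately show ?thesis using cong_in_I_iff by blast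
    qed
    then show ?thesis using v by (simp add: A_def)
  qed
  moreover have "P v2 \<in> B"
  proof -
    have "P v1 \<cdot> x \<cdot> P v2 \<in> I" if "x \<in> C" for x
      using corner_zero[OF v _ that] sep by blast
    then show ?thesis using v(2) by (simp add: B_def)
  qed
  moreover have "A \<subseteq> I \<or> B \<subseteq> I" by (rule q_primeD[OF prime A B]) (simp add: A_def)
  ultimately show False using P_notin_I[OF v(1) one] P_notin_I[OF v(2) one] by blast
qed

lemma domain_MT3_imp_prime:
  assumes dom: "integral_domain_ring TYPE('r)" and MT3: "MT3 M V r s" and V: "V \<noteq> {}"
  shows "q_prime"
proof (rule q_primeI)
  obtain v where v: "v \<in> V" using V by blast
  have "P v \<notin> I" using P_notin_I[OF v] dom by (simp add: integral_domain_ring_def)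
  then show "\<not> C \<subseteq> I" using P_carrier[OF v] by blast
next
  fix x y assume x: "x \<in> C" "x \<notin> I" and y: "y \<in> C" "y \<notin> I"
  obtain l m a where lm: "l \<in> M" "m \<in> M" "s l = s m" "leads (T l \<cdot> x \<cdot> S m) a (s m)" "fa_smul a (P (s m)) \<notin> I"
    using leads_compress[OF x] by blast
  obtain l' m' b where lm': "l' \<in> M" "m' \<in> M" "s l' = s m'" "leads (T l' \<cdot> y \<cdot> S m') b (s m')" "fa_smul b (P (s m')) \<notin> I"
    using leads_compress[OF y] by blast
  have "s m \<in> V" "s m' \<in> V" using lm lm' by auto
  \<comment> \<open>MT3 joins the vertices of the two compressed elements by paths with a common
    source; conjugating by these paths puts both leading terms at that vertex.\<close>
  then obtain u u' where u: "u \<in> M" "r u = s m" "u' \<in> M" "r u' = s m'" "s u = s u'"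
    using MT3 unfolding MT3_def by metis
  have lead: "leads (T u \<cdot> (T l \<cdot> x \<cdot> S m) \<cdot> S u) a (s u)"
    using leads_conj[OF lm(4) u(1,2)] .
  have lead': "leads (T u' \<cdot> (T l' \<cdot> y \<cdot> S m') \<cdot> S u') b (s u)"
    using leads_conj[OF lm'(4) u(3,4)] u(5) by simp
  have "a \<noteq> 0" "b \<noteq> 0" using lm(5) lm'(5) by auto
  then have "a * b \<noteq> 0" using dom by (auto simp: integral_domain_ring_def)
  then have "fa_smul (a * b) (P (s u)) \<notin> I" using smul_P_in_I_iff[of "s u"] u by simp
  then have "(T u \<cdot> (T l \<cdot> x \<cdot> S m) \<cdot> S u) \<cdot> (T u' \<cdot> (T l' \<cdot> y \<cdot> S m') \<cdot> S u') \<notin> I"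
    using leads_mul[OF lead lead'] u by auto
  \<comment> \<open>Rebracketing collects the outer factors into the single multipliers that
    \<open>q_primeI\<close> asks for.\<close>
  then have "fa_mul (fa_mul (fa_mul (T u \<cdot> T l) x) (S m \<cdot> S u)) (fa_mul (fa_mul (T u' \<cdot> T l') y) (S m' \<cdot> S u')) \<notin> I"
    by (simp add: fa_mul_assoc)
  moreover have "T u \<cdot> T l \<in> C" "S m \<cdot> S u \<in> C" "T u' \<cdot> T l' \<in> C" "S m' \<cdot> S u' \<in> C"
    using lm lm' u by auto
  ultimately show "\<exists>a b e f. a \<in> C \<and> b \<in> C \<and> e \<in> C \<and> f \<in> C \<and>
         fa_mul (fa_mul (fa_mul a x) b) (fa_mul (fa_mul e y) f) \<notin> I" by blast
qed

end

theorem theorem4p4: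
  fixes k :: nat and M V :: "'m set" and r s :: "'m \<Rightarrow> 'm"
    and c :: "'m \<Rightarrow> 'm \<Rightarrow> 'm" and d :: "'m \<Rightarrow> nat \<Rightarrow> nat"
  assumes "k \<ge> 1"
    and "is_kgraph k M V r s c d"
    and "V \<noteq> {}"
    and "row_finite M V r d"
    and "locally_convex k M V r s d"
  shows "KP_prime TYPE('r::comm_ring_1) k M V r s c d \<longleftrightarrow>
           integral_domain_ring TYPE('r) \<and> MT3 M V r s"
proof -
  interpret kp_convex k M V r s c d "TYPE('r)"
    by unfold_locales (use assms in auto)
  have "KP_prime TYPE('r) k M V r s c d \<longleftrightarrow> q_prime"
    by (simp add: KP_prime_def Let_def I_def)
  moreover have "q_prime \<Longrightarrow> integral_domain_ring TYPE('r)"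
    using prime_imp_domain assms(3) by blast
  moreover have "q_prime \<Longrightarrow> MT3 M V r s"
    using prime_imp_MT3 calculation(2) by (simp add: integral_domain_ring_def)
  ultimately show ?thesis using domain_MT3_imp_prime assms(3) by blast
qed

end
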